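(* Let $W$ be a Weyl tensor of Petrov type D, with canonical expression $\mathcal W=2\rho\,\mathcal U\otimes\mathcal U-\rho\,\mathcal L\,\tilde\otimes\,\mathcal K$, $\rho\neq0$, where $\{\mathcal U,\mathcal L,\mathcal K\}$ is a null frame of self-dual bivectors, and let $t=|\rho|^2$. Define $$\Pi=\mathcal U\cdot\overline{\mathcal U},\ \Lambda=\mathcal L\cdot\overline{\mathcal L},\ \mathrm K=\mathcal K\cdot\overline{\mathcal K},\ \mathrm N=\mathcal U\cdot\overline{\mathcal L},\ \Omega=\mathcal U\cdot\overline{\mathcal K},\ \mathrm M=\mathcal L\cdot\overline{\mathcal K}.$$ Then the Bel-Robinson tensor $T$ of $W$ admits the canonical expression $$T=4t\,\Pi\otimes\Pi-2t\,(\Omega\,\tilde\otimes\,\mathrm N+\overline\Omega\,\tilde\otimes\,\overline{\mathrm N})+t\,(\Lambda\,\tilde\otimes\,\mathrm K+\mathrm M\,\tilde\otimes\,\overline{\mathrm M}).$$ The eigenvalue $4t$ is simple and is associated with the eigentensor $\Pi$. Associated with the quadruple eigenvalue $t$ we have the eigenspace $R_t=\langle\Lambda,\mathrm K,\mathrm M_R,\mathrm M_I\rangle$. Associated with the quadruple eigenvalue $-2t$ we have the eigenspace $R_{-2t}=\langle\mathrm N_R,\Omega_R,\mathrm N_I,\Omega_I\rangle$. Here $\Psi_R,\Psi_I$ denote the real and imaginary parts of a complex symmetric tensor $\Psi$.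
   Context: $(V,g)$ is an oriented 4-dimensional real vector space with a Lorentzian metric of signature $(-,+,+,+)$ (the tangent space of a space-time at a point); indices are moved with $g$; $\eta$ is the metric volume element; $( *F)_{\alpha\beta}=\frac12\eta_{\alpha\beta\mu\nu}F^{\mu\nu}$, $( *W)_{\alpha\beta\mu\nu}=\frac12\eta_{\alpha\beta}{}^{\rho\sigma}W_{\rho\sigma\mu\nu}$. A self-dual (SD) bivector is a complex 2-form $\mathcal F$ with $*\mathcal F=\mathrm i\mathcal F$; these form a complex 3-dimensional space with metric $\mathcal G(\mathcal F,\mathcal H)=\frac12\mathcal F_{\alpha\beta}\mathcal H^{\alpha\beta}$. A null frame $\{\mathcal U,\mathcal L,\mathcal K\}$ of SD bivectors satisfies $\mathcal G(\mathcal U,\mathcal U)=-1$, $\mathcal G(\mathcal L,\mathcal K)=-1$, all other products being zero. $A\,\tilde\otimes\,B=A\otimes B+B\otimes A$. A Weyl tensor $W$ is a real 4-tensor with the algebraic symmetries of a Riemann tensor and vanishing traces; $\mathcal W=\frac12(W-\mathrm i*W)$ acts on SD bivectors by $\mathcal W(\mathcal F)_{\alpha\beta}=\frac12\mathcal W_{\alpha\beta}{}^{\mu\nu}\mathcal F_{\mu\nu}$. Type D means that this map has a simple eigenvalue $-2\rho$ and a double eigenvalue $\rho\ne0$ and is diagonalizable; it is known that then the canonical expression of the claim exists. The Bel-Robinson (BR) tensor of $W$ is $T_{\alpha\mu\beta\nu}=\mathcal W_{\alpha}{}^{\rho}{}_{\beta}{}^{\sigma}\,\overline{\mathcal W}_{\mu\rho\nu\sigma}$;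 it is totally symmetric and traceless and acts on the 9-dimensional space of traceless symmetric 2-tensors by $T(A)_{\alpha\beta}=T_{\alpha\beta}{}^{\mu\nu}A_{\mu\nu}$; an eigentensor is an eigenvector of this map. For 2-tensors $(A\cdot B)_{\alpha\beta}=A_{\alpha}{}^{\mu}B_{\mu\beta}$. $\langle\cdot\rangle$ denotes linear span. *)

theory Defs
  imports "HOL-Analysis.Analysis"
begin

text \<open>
  Tensors on the oriented Lorentzian vector space are given by their covariant components in an
  arbitrary fixed basis, so the metric \<open>g\<close> is an arbitrary symmetric matrix of signature
  \<open>(-,+,+,+)\<close>. The orientation is recorded by \<open>\<epsilon>\<close>, which is \<open>1\<close> if the basis is positively
  oriented and \<open>-1\<close> otherwise. Real tensors occurring together with complex ones are regarded as
  complex tensors with real components.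
\<close>

type_synonym rmetric = "real^4^4"
type_synonym tensor2 = "complex^4^4"
type_synonym tensor4 = "complex^4^4^4^4"

definition minkowski :: "real^4^4" where
  "minkowski = (\<chi> i j. if i \<noteq> j then 0 else if i = 1 then -1 else 1)"

definition lorentzian :: "rmetric \<Rightarrow> bool" where
  "lorentzian g \<longleftrightarrow> transpose g = g \<and>
     (\<exists>P :: real^4^4. invertible P \<and> transpose P ** g ** P = minkowski)"

definition orientation :: "real \<Rightarrow> bool" where
  "orientation \<epsilon> \<longleftrightarrow> \<epsilon> = 1 \<or> \<epsilon> = -1"

text \<open>The contravariant metric, used to raise indices.\<close>

definition ginv :: "rmetric \<Rightarrow> 4 \<Rightarrow> 4 \<Rightarrow> complex" where
  "ginv g a b = complex_of_real (matrix_inv g $ a $ b)"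

text \<open>The determinant below is the Levi-Civita symbol, with value \<open>1\<close> at \<open>(1,2,3,4)\<close>.\<close>

definition vol :: "real \<Rightarrow> rmetric \<Rightarrow> 4 \<Rightarrow> 4 \<Rightarrow> 4 \<Rightarrow> 4 \<Rightarrow> complex" where
  "vol \<epsilon> g a b c d = complex_of_real (\<epsilon> * sqrt \<bar>det g\<bar> *
     det ((\<chi> i. if i = 1 then axis a 1 else if i = 2 then axis b 1
               else if i = 3 then axis c 1 else (axis d 1 :: real^4)) :: real^4^4))"

definition dual2 :: "real \<Rightarrow> rmetric \<Rightarrow> tensor2 \<Rightarrow> tensor2" where
  "dual2 \<epsilon> g F = (\<chi> a b. 1/2 * (\<Sum>m\<in>UNIV. \<Sum>n\<in>UNIV. \<Sum>p\<in>UNIV. \<Sum>q\<in>UNIV.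
     vol \<epsilon> g a b m n * ginv g m p * ginv g n q * F $ p $ q))"

definition dual4 :: "real \<Rightarrow> rmetric \<Rightarrow> tensor4 \<Rightarrow> tensor4" where
  "dual4 \<epsilon> g W = (\<chi> a b m n. 1/2 * (\<Sum>r\<in>UNIV. \<Sum>s\<in>UNIV. \<Sum>p\<in>UNIV. \<Sum>q\<in>UNIV.
     vol \<epsilon> g a b r s * ginv g r p * ginv g s q * W $ p $ q $ m $ n))"

definition cscale2 :: "complex \<Rightarrow> tensor2 \<Rightarrow> tensor2" where
  "cscale2 c A = (\<chi> a b. c * A $ a $ b)"

definition cscale4 :: "complex \<Rightarrow> tensor4 \<Rightarrow> tensor4" where
  "cscale4 c A = (\<chi> a b m n. c * A $ a $ b $ m $ n)"

definition cnj2 :: "tensor2 \<Rightarrow> tensor2" where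
  "cnj2 A = (\<chi> a b. cnj (A $ a $ b))"

definition Re2 :: "tensor2 \<Rightarrow> tensor2" where
  "Re2 A = (\<chi> a b. complex_of_real (Re (A $ a $ b)))"

definition Im2 :: "tensor2 \<Rightarrow> tensor2" where
  "Im2 A = (\<chi> a b. complex_of_real (Im (A $ a $ b)))"

definition tensor_prod :: "tensor2 \<Rightarrow> tensor2 \<Rightarrow> tensor4"  (infixl "\<otimes>\<^sub>t" 77) where
  "A \<otimes>\<^sub>t B = (\<chi> a b m n. A $ a $ b * B $ m $ n)"

definition sym_tensor_prod :: "tensor2 \<Rightarrow> tensor2 \<Rightarrow> tensor4"  (infixl "\<otimes>\<^sub>s" 77) where
  "A \<otimes>\<^sub>s B = A \<otimes>\<^sub>t B + B \<otimes>\<^sub>t A"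

definition dot2 :: "rmetric \<Rightarrow> tensor2 \<Rightarrow> tensor2 \<Rightarrow> tensor2" where
  "dot2 g A B = (\<chi> a b. \<Sum>m\<in>UNIV. \<Sum>n\<in>UNIV. A $ a $ n * ginv g n m * B $ m $ b)"

definition sd_bivectors :: "real \<Rightarrow> rmetric \<Rightarrow> tensor2 set" where
  "sd_bivectors \<epsilon> g =
     {F. (\<forall>a b. F $ a $ b = - F $ b $ a) \<and> dual2 \<epsilon> g F = cscale2 \<i> F}"

definition sd_metric :: "rmetric \<Rightarrow> tensor2 \<Rightarrow> tensor2 \<Rightarrow> complex" where
  "sd_metric g F H = 1/2 * (\<Sum>a\<in>UNIV. \<Sum>b\<in>UNIV. \<Sum>m\<in>UNIV. \<Sum>n\<in>UNIV.
     F $ a $ b * ginv g a m * ginv g b n * H $ m $ n)"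

definition null_frame :: "real \<Rightarrow> rmetric \<Rightarrow> tensor2 \<Rightarrow> tensor2 \<Rightarrow> tensor2 \<Rightarrow> bool" where
  "null_frame \<epsilon> g U L K \<longleftrightarrow>
     U \<in> sd_bivectors \<epsilon> g \<and> L \<in> sd_bivectors \<epsilon> g \<and> K \<in> sd_bivectors \<epsilon> g \<and>
     sd_metric g U U = -1 \<and> sd_metric g L K = -1 \<and>
     sd_metric g U L = 0 \<and> sd_metric g U K = 0 \<and>
     sd_metric g L L = 0 \<and> sd_metric g K K = 0"

definition weyl_tensor :: "rmetric \<Rightarrow> tensor4 \<Rightarrow> bool" where
  "weyl_tensor g W \<longleftrightarrow>
     (\<forall>a b c d. W $ a $ b $ c $ d \<in> \<real>) \<and>
     (\<forall>a b c d. W $ b $ a $ c $ d = - W $ a $ b $ c $ d) \<and>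
     (\<forall>a b c d. W $ a $ b $ d $ c = - W $ a $ b $ c $ d) \<and>
     (\<forall>a b c d. W $ c $ d $ a $ b = W $ a $ b $ c $ d) \<and>
     (\<forall>a b c d. W $ a $ b $ c $ d + W $ a $ c $ d $ b + W $ a $ d $ b $ c = 0) \<and>
     (\<forall>b d. (\<Sum>a\<in>UNIV. \<Sum>c\<in>UNIV. ginv g a c * W $ a $ b $ c $ d) = 0)"

definition sd_weyl :: "real \<Rightarrow> rmetric \<Rightarrow> tensor4 \<Rightarrow> tensor4" where
  "sd_weyl \<epsilon> g W = cscale4 (1/2) (W - cscale4 \<i> (dual4 \<epsilon> g W))"

definition sd_weyl_map :: "real \<Rightarrow> rmetric \<Rightarrow> tensor4 \<Rightarrow> tensor2 \<Rightarrow> tensor2" where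
  "sd_weyl_map \<epsilon> g W F = (\<chi> a b. 1/2 * (\<Sum>m\<in>UNIV. \<Sum>n\<in>UNIV. \<Sum>p\<in>UNIV. \<Sum>q\<in>UNIV.
     sd_weyl \<epsilon> g W $ a $ b $ p $ q * ginv g p m * ginv g q n * F $ m $ n))"

text \<open>The space of self-dual bivectors has a complex basis of eigenvectors, with eigenvalues
  \<open>-2\<rho>, \<rho>, \<rho>\<close>.\<close>

definition petrov_type_D :: "real \<Rightarrow> rmetric \<Rightarrow> tensor4 \<Rightarrow> bool" where
  "petrov_type_D \<epsilon> g W \<longleftrightarrow> (\<exists>\<rho> E F H. \<rho> \<noteq> 0 \<and>
     E \<in> sd_bivectors \<epsilon> g \<and> F \<in> sd_bivectors \<epsilon> g \<and> H \<in> sd_bivectors \<epsilon> g \<and>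
     (\<forall>X \<in> sd_bivectors \<epsilon> g. \<exists>!(x, y, z). X = cscale2 x E + cscale2 y F + cscale2 z H) \<and>
     sd_weyl_map \<epsilon> g W E = cscale2 (-2 * \<rho>) E \<and>
     sd_weyl_map \<epsilon> g W F = cscale2 \<rho> F \<and>
     sd_weyl_map \<epsilon> g W H = cscale2 \<rho> H)"

definition bel_robinson :: "real \<Rightarrow> rmetric \<Rightarrow> tensor4 \<Rightarrow> tensor4" where
  "bel_robinson \<epsilon> g W = (\<chi> a m b n. \<Sum>p\<in>UNIV. \<Sum>q\<in>UNIV. \<Sum>r\<in>UNIV. \<Sum>s\<in>UNIV.
     sd_weyl \<epsilon> g W $ a $ p $ b $ q * ginv g p r * ginv g q s *
     cnj (sd_weyl \<epsilon> g W $ m $ r $ n $ s))"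

definition tensor_map :: "rmetric \<Rightarrow> tensor4 \<Rightarrow> tensor2 \<Rightarrow> tensor2" where
  "tensor_map g T A = (\<chi> a b. \<Sum>m\<in>UNIV. \<Sum>n\<in>UNIV. \<Sum>p\<in>UNIV. \<Sum>q\<in>UNIV.
     T $ a $ b $ p $ q * ginv g p m * ginv g q n * A $ m $ n)"

text \<open>The 9-dimensional real vector space of traceless symmetric real 2-tensors. Below,
  \<open>span\<close> and \<open>dim\<close> refer to the real vector space structure of \<^typ>\<open>tensor2\<close>.\<close>

definition traceless_sym :: "rmetric \<Rightarrow> tensor2 set" where
  "traceless_sym g = {A. (\<forall>a b. A $ a $ b \<in> \<real>) \<and> (\<forall>a b. A $ a $ b = A $ b $ a) \<and>
     (\<Sum>a\<in>UNIV. \<Sum>b\<in>UNIV. ginv g a b * A $ a $ b) = 0}"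

definition eigenspace :: "rmetric \<Rightarrow> tensor4 \<Rightarrow> real \<Rightarrow> tensor2 set" where
  "eigenspace g T l = {A \<in> traceless_sym g. tensor_map g T A = l *\<^sub>R A}"

text \<open>The algebraic multiplicity of an eigenvalue: the dimension of its generalized eigenspace.\<close>

definition alg_multiplicity :: "rmetric \<Rightarrow> tensor4 \<Rightarrow> real \<Rightarrow> nat" where
  "alg_multiplicity g T l =
     dim {A \<in> traceless_sym g. \<exists>k. ((\<lambda>B. tensor_map g T B - l *\<^sub>R B) ^^ k) A = 0}"

end

theory Submission
  imports Defs
begin

text \<open>
  Since \<open>\<W>\<close> is a combination of products of self-dual bivectors, contracting it with its conjugate
  gives at once a combination of products of the tensors \<open>F \<cdot> cnj H\<close>, where \<open>F, H\<close> run through the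
  null frame. A self-dual and an anti-self-dual bivector commute and have traceless product, so
  \<open>F \<cdot> cnj H\<close> is symmetric and traceless, with conjugate \<open>H \<cdot> cnj F\<close>; moreover
  \<open>\<langle>F \<cdot> cnj H, F' \<cdot> cnj H'\<rangle> = \<G>(F, F') cnj \<G>(H, H')\<close>. These identities are polynomial and are
  verified in an orthonormal basis, where self-duality leaves three free components. They determine
  the Gram matrix of the nine real tensors of the claim: it is nondegenerate, so they form a basis of
  the nine-dimensional space of traceless symmetric tensors, and \<open>T\<close> is diagonal in it.
\<close>

subsection \<open>Diagonalizable maps\<close>

text \<open>A functional that vanishes on \<open>B - {x}\<close> vanishes on its span, so
  \<open>x\<close> cannot lie there. Dual functionals will come from the pairing of
  2-tensors.\<close>

lemma independent_dual:
  fixes B :: "'a::real_vector set"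
  assumes "\<And>x. x \<in> B \<Longrightarrow> \<exists>f. linear f \<and> f x \<noteq> (0::real) \<and> (\<forall>y\<in>B - {x}. f y = 0)"
  shows "independent B"
proof
  assume "dependent B"
  then obtain x where x: "x \<in> B" "x \<in> span (B - {x})" by (auto simp: dependent_def)
  from assms[OF x(1)] obtain f :: "'a \<Rightarrow> real" where f: "linear f" "f x \<noteq> 0" "\<forall>y\<in>B - {x}. f y = 0" by blast
  have "f x = 0" by (rule linear_eq_0_on_span[OF f(1) _ x(2)]) (use f(3) in auto)
  with f(2) show False by simp
qed

text \<open>In an eigenbasis the \<open>k\<close>-th power of \<open>f - l\<close> multiplies the
  coefficient at \<open>b\<close> by \<open>(\<mu> b - l) ^ k\<close>. If the result is
  \<open>0\<close>, only coefficients with \<open>\<mu> b = l\<close> survive. Generalized and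
  ordinary eigenspaces therefore agree, and both are spanned by the basis elements with eigenvalue
  \<open>l\<close>.\<close>

lemma eigenspace_eigenbasis:
  fixes f :: "'a::euclidean_space \<Rightarrow> 'a"
  assumes f: "linear f" and ind: "independent B"
    and diag: "\<And>b. b \<in> B \<Longrightarrow> \<exists>c. f b = c *\<^sub>R b"
  shows "{v \<in> span B. \<exists>k. ((\<lambda>w. f w - l *\<^sub>R w) ^^ k) v = 0} = span {b \<in> B. f b = l *\<^sub>R b}"
    and "{v \<in> span B. f v = l *\<^sub>R v} = span {b \<in> B. f b = l *\<^sub>R b}"
proof -
  obtain \<mu> where eig: "\<And>b. b \<in> B \<Longrightarrow> f b = \<mu> b *\<^sub>R b" using diag by metis
  have "b \<noteq> 0" if "b \<in> B" for b using ind that dependent_zero by blast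
  then have set_eq: "{b \<in> B. f b = l *\<^sub>R b} = {b \<in> B. \<mu> b = l}" using eig by auto
  have fin: "finite B" using ind by (rule independent_imp_finite)
  define h where "h = (\<lambda>w. f w - l *\<^sub>R w)"
  have h: "linear h" unfolding h_def by (intro linear_compose_sub f linear_scaleR)
  have h_pow: "linear (h ^^ k)" for k
    by (induction k) (use h in \<open>auto simp: linear_id id_def[symmetric] intro: linear_compose[unfolded o_def]\<close>)
  have hb: "(h ^^ k) b = (\<mu> b - l) ^ k *\<^sub>R b" if "b \<in> B" for b k
    by (induction k) (simp_all add: linear_scale[OF h], simp add: h_def eig that algebra_simps)
  have gen: "v \<in> span {b \<in> B. \<mu> b = l}" if v: "v \<in> span B" and k: "(h ^^ k) v = 0" for v k
  proof -
    obtain u where u: "v = (\<Sum>b\<in>B. u b *\<^sub>R b)" using v fin by (auto simp: span_finite)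
    have "(\<Sum>b\<in>B. (u b * (\<mu> b - l) ^ k) *\<^sub>R b) = 0"
      using k by (simp add: u linear_sum[OF h_pow] linear_scale[OF h_pow] hb)
    then have "u b * (\<mu> b - l) ^ k = 0" if "b \<in> B" for b
      
      by (rule independentD[OF ind fin subset_refl]) (use that in auto)
    then have "u b = 0" if "b \<in> B" "\<mu> b \<noteq> l" for b using that by force
    then have "v = (\<Sum>b\<in>{b \<in> B. \<mu> b = l}. u b *\<^sub>R b)"
      unfolding u by (intro sum.mono_neutral_right) (use fin in auto)
    then show ?thesis by (auto intro!: span_sum span_scale intro: span_base)
  qed
  have eig_span: "f v = l *\<^sub>R v" if "v \<in> span {b \<in> B. \<mu> b = l}" for v
    by (rule linear_eq_on_span[OF f linear_scaleR _ that]) (use eig in auto)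
  have sub: "span {b \<in> B. \<mu> b = l} \<subseteq> span B" by (intro span_mono) auto
  have one: "(h ^^ 1) v = 0 \<longleftrightarrow> f v = l *\<^sub>R v" for v by (simp add: h_def)
  show "{v \<in> span B. \<exists>k. ((\<lambda>w. f w - l *\<^sub>R w) ^^ k) v = 0} = span {b \<in> B. f b = l *\<^sub>R b}"
    unfolding h_def[symmetric] set_eq using gen eig_span sub one by blast
  show "{v \<in> span B. f v = l *\<^sub>R v} = span {b \<in> B. f b = l *\<^sub>R b}"
    unfolding set_eq using gen eig_span sub one by blast
qed

subsection \<open>Change of basis and duality\<close>

lemma det_4:
  "det (A::'a::comm_ring_1^4^4) =
     A$1$1 * (A$2$2 * (A$3$3 * A$4$4 - A$3$4 * A$4$3) - A$2$3 * (A$3$2 * A$4$4 - A$3$4 * A$4$2)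
            + A$2$4 * (A$3$2 * A$4$3 - A$3$3 * A$4$2))
   - A$1$2 * (A$2$1 * (A$3$3 * A$4$4 - A$3$4 * A$4$3) - A$2$3 * (A$3$1 * A$4$4 - A$3$4 * A$4$1)
            + A$2$4 * (A$3$1 * A$4$3 - A$3$3 * A$4$1))
   + A$1$3 * (A$2$1 * (A$3$2 * A$4$4 - A$3$4 * A$4$2) - A$2$2 * (A$3$1 * A$4$4 - A$3$4 * A$4$1)
            + A$2$4 * (A$3$1 * A$4$2 - A$3$2 * A$4$1))
   - A$1$4 * (A$2$1 * (A$3$2 * A$4$3 - A$3$3 * A$4$2) - A$2$2 * (A$3$1 * A$4$3 - A$3$3 * A$4$1)
            + A$2$3 * (A$3$1 * A$4$2 - A$3$2 * A$4$1))"
proof -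
  have f1234: "finite {2::4, 3, 4}" "1 \<notin> {2::4, 3, 4}" by auto
  have f234: "finite {3::4, 4}" "2 \<notin> {3::4, 4}" by auto
  have f34: "finite {4::4}" "3 \<notin> {4::4}" by auto
  show ?thesis
    unfolding det_def UNIV_4
    unfolding sum_over_permutations_insert[OF f1234]
    unfolding sum_over_permutations_insert[OF f234]
    unfolding sum_over_permutations_insert[OF f34]
    unfolding permutes_sing
    by (simp add: sign_swap_id permutation_swap_id sign_compose permutation_compose sign_id
        swap_id_eq algebra_simps)
qed

text \<open>The Levi-Civita symbol is the determinant of such a matrix with unit vectors as rows.
  Allowing arbitrary rows turns it into an alternating form that can be evaluated on the columns of
  a change of basis.\<close>

definition rows4 :: "'a^4 \<Rightarrow> 'a^4 \<Rightarrow> 'a^4 \<Rightarrow> 'a^4 \<Rightarrow> 'a^4^4" where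
  "rows4 x y z w = (\<chi> i. if i = 1 then x else if i = 2 then y else if i = 3 then z else w)"

lemma linear_det_row:
  fixes r :: "'n::finite \<Rightarrow> real^'n"
  shows "linear (\<lambda>v. det (\<chi> i. if i = k then v else r i))"
proof (rule linearI)
  show "det (\<chi> i. if i = k then x + y else r i) =
      det (\<chi> i. if i = k then x else r i) + det (\<chi> i. if i = k then y else r i)" for x y
    by (rule det_row_add)
  show "det (\<chi> i. if i = k then c *\<^sub>R x else r i) = c *\<^sub>R det (\<chi> i. if i = k then x else r i)" for c x
    using det_row_mul[of k c "\<lambda>_. x" r] by (simp add: scalar_mult_eq_scaleR cong: if_cong)
qed

lemma linear_det_rows4:
  shows "linear (\<lambda>x. det (rows4 x y z w :: real^4^4))"
    and "linear (\<lambda>y. det (rows4 x y z w :: real^4^4))"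
    and "linear (\<lambda>z. det (rows4 x y z w :: real^4^4))"
    and "linear (\<lambda>w. det (rows4 x y z w :: real^4^4))"
proof -
  have *: "rows4 x y z w = (\<chi> i. if i = 1 then x else rows4 0 y z w $ i)"
     "rows4 x y z w = (\<chi> i. if i = 2 then y else rows4 x 0 z w $ i)"
     "rows4 x y z w = (\<chi> i. if i = 3 then z else rows4 x y 0 w $ i)"
     "rows4 x y z w = (\<chi> i. if i = 4 then w else rows4 x y z 0 $ i)" for x y z w :: "real^4"
    by (simp_all add: rows4_def vec_eq_iff forall_4)
  show "linear (\<lambda>x. det (rows4 x y z w :: real^4^4))"
    by (subst *(1)) (rule linear_det_row)
  show "linear (\<lambda>y. det (rows4 x y z w :: real^4^4))"
    by (subst *(2)) (rule linear_det_row)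
  show "linear (\<lambda>z. det (rows4 x y z w :: real^4^4))"
    by (subst *(3)) (rule linear_det_row)
  show "linear (\<lambda>w. det (rows4 x y z w :: real^4^4))"
    by (subst *(4)) (rule linear_det_row)
qed

text \<open>Contracting an index with the components of a vector is the same as inserting the
  vector, by expansion in the standard basis.\<close>

lemma linear_sum_axis:
  fixes f :: "real^'n \<Rightarrow> complex"
  assumes "linear f"
  shows "(\<Sum>i\<in>UNIV. complex_of_real (x $ i) * f (axis i 1)) = f x"
proof -
  have "f x = f (\<Sum>i\<in>UNIV. x $ i *\<^sub>R axis i 1)"
    by (simp add: basis_expansion flip: scalar_mult_eq_scaleR)
  also have "\<dots> = (\<Sum>i\<in>UNIV. complex_of_real (x $ i) * f (axis i 1))"
    using assms by (simp add: linear_sum linear_scale scaleR_conv_of_real[where 'a=complex])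
  finally show ?thesis ..
qed

text \<open>Picking rows of \<open>A\<close> is multiplication from the left by the matrix of the
  corresponding unit vectors. Multiplicativity of \<open>det\<close> also covers repeated
  indices.\<close>

lemma det_rows4_matrix:
  fixes A :: "real^4^4"
  shows "det (rows4 (A $ a) (A $ b) (A $ c) (A $ d)) =
    det (rows4 (axis a 1) (axis b 1) (axis c 1) (axis d 1)) * det A"
proof -
  have axis_matrix: "(\<Sum>k\<in>UNIV. axis i 1 $ k * A $ k $ j) = A $ i $ j" for i j
    by (simp add: axis_def if_distrib if_distribR sum.delta cong: if_cong)
  have "rows4 (A $ a) (A $ b) (A $ c) (A $ d) =
      rows4 (axis a 1) (axis b 1) (axis c 1) (axis d 1) ** A"
    using axis_matrix by (simp add: vec_eq_iff forall_4 rows4_def matrix_matrix_mult_def)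
  then show ?thesis by (simp add: det_mul)
qed

section \<open>Complexified matrices and the change to an orthonormal basis\<close>

definition cmat :: "real^'n^'m \<Rightarrow> complex^'n^'m" where
  "cmat A = (\<chi> i j. complex_of_real (A $ i $ j))"

lemma cmat_mult: "cmat (A ** B) = cmat A ** cmat B"
  by (simp add: cmat_def matrix_matrix_mult_def vec_eq_iff)

lemma cmat_transpose: "cmat (transpose A) = transpose (cmat A)"
  by (simp add: cmat_def transpose_def)

lemma cmat_one: "cmat (mat 1) = mat 1"
  by (simp add: cmat_def mat_def vec_eq_iff)

text \<open>Full contractions become traces, so that changes of basis are carried out by cyclicity
  of the trace.\<close>

lemma sum_mult_eq_trace:
  fixes A B :: "'a::comm_semiring_1^'n^'n"
  shows "(\<Sum>i\<in>UNIV. \<Sum>j\<in>UNIV. A $ i $ j * B $ i $ j) = trace (transpose A ** B)"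
  by (subst sum.swap) (simp add: trace_def matrix_matrix_mult_def transpose_def)

lemma congruence_bilinear:
  fixes \<beta> :: "real^'n \<Rightarrow> real^'n \<Rightarrow> complex" and P :: "real^'n^'n"
  assumes "\<And>y. linear (\<lambda>x. \<beta> x y)" and "\<And>x. linear (\<beta> x)"
  shows "transpose (cmat P) ** (\<chi> m n. \<beta> (axis m 1) (axis n 1)) ** cmat P =
    (\<chi> i j. \<beta> (column i P) (column j P))"
proof -
  have "(\<Sum>n\<in>UNIV. (\<Sum>m\<in>UNIV. complex_of_real (P $ m $ i) * \<beta> (axis m 1) (axis n 1)) *
      complex_of_real (P $ n $ j)) = \<beta> (column i P) (column j P)" for i j
  proof -
    have "(\<Sum>m\<in>UNIV. complex_of_real (P $ m $ i) * \<beta> (axis m 1) y) = \<beta> (column i P) y"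
      "(\<Sum>n\<in>UNIV. \<beta> x (axis n 1) * complex_of_real (P $ n $ j)) = \<beta> x (column j P)" for x y
      using linear_sum_axis[OF assms(1), of "column i P"] linear_sum_axis[OF assms(2), of "column j P"]
      by (simp_all add: column_def mult.commute)
    then show ?thesis by simp
  qed
  then show ?thesis
    by (simp add: matrix_matrix_mult_def transpose_def cmat_def)
qed

lemma matrix_inv_eqI:
  fixes A B :: "'a::field^'n^'n"
  assumes "A ** B = mat 1"
  shows "matrix_inv A = B"
proof -
  have B: "B ** A = mat 1" using assms by (simp add: matrix_left_right_inverse)
  have "A ** matrix_inv A = mat 1 \<and> matrix_inv A ** A = mat 1"
    unfolding matrix_inv_def by (rule someI[of _ B]) (simp add: assms B)
  then have "matrix_inv A ** (A ** B) = B" by (simp add: matrix_mul_assoc)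
  then show ?thesis by (simp add: assms)
qed

lemma minkowski_square: "minkowski ** minkowski = mat 1"
  by (simp add: minkowski_def matrix_matrix_mult_def mat_def vec_eq_iff forall_4 sum_4)

lemma matrix_inv_minkowski: "matrix_inv minkowski = minkowski"
  by (rule matrix_inv_eqI[OF minkowski_square])

text \<open>The hypothesis says that \<open>g ** P ** minkowski\<close> is a right inverse of
  \<open>transpose P\<close>. For square matrices it is also a left inverse, and this exhibits the
  inverse of \<open>g\<close>.\<close>

lemma matrix_inv_lorentz_basis:
  fixes P g :: "real^4^4"
  assumes "transpose P ** g ** P = minkowski"
  shows "matrix_inv g = P ** minkowski ** transpose P"
proof -
  have "transpose P ** (g ** P ** minkowski) = mat 1"
    using assms minkowski_square by (simp add: matrix_mul_assoc)
  then have "g ** P ** minkowski ** transpose P = mat 1"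
    by (rule matrix_left_right_inverse[THEN iffD1])
  then show ?thesis by (intro matrix_inv_eqI) (simp add: matrix_mul_assoc)
qed

lemma vol_eq_rows4:
  "vol \<epsilon> g a b c d = complex_of_real (\<epsilon> * sqrt \<bar>det g\<bar> *
     det (rows4 (axis a 1) (axis b 1) (axis c 1) (axis d 1)))"
  by (simp add: vol_def rows4_def)

lemma dual2_eq:
  "dual2 \<epsilon> g F = (\<chi> a b. complex_of_real (\<epsilon> * sqrt \<bar>det g\<bar>) / 2 * (\<Sum>m\<in>UNIV. \<Sum>n\<in>UNIV.
     complex_of_real (det (rows4 (axis a 1) (axis b 1) (axis m 1) (axis n 1))) *
     (cmat (matrix_inv g) ** F ** transpose (cmat (matrix_inv g))) $ m $ n))"
proof -
  have "(\<Sum>p\<in>UNIV. \<Sum>q\<in>UNIV. ginv g m p * ginv g n q * F $ p $ q) =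
      (cmat (matrix_inv g) ** F ** transpose (cmat (matrix_inv g))) $ m $ n" for m n
    by (subst sum.swap)
      (simp add: matrix_matrix_mult_def cmat_def ginv_def transpose_def sum_distrib_left sum_distrib_right ac_simps)
  then show ?thesis
    by (simp add: dual2_def vol_eq_rows4 vec_eq_iff mult.assoc flip: sum_distrib_left)
qed

text \<open>The Levi-Civita symbol acquires the factor \<open>det P\<close> in the new basis, while
  \<open>sqrt \<bar>det g\<bar>\<close> is the reciprocal of \<open>\<bar>det P\<bar>\<close>. Their
  product is the sign of \<open>det P\<close>, which records whether \<open>P\<close> preserves the
  orientation.\<close>

lemma dual2_congruence:
  assumes P: "transpose P ** g ** P = minkowski"
  shows "dual2 (\<epsilon> * sgn (det P)) minkowski (transpose (cmat P) ** F ** cmat P) =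
    transpose (cmat P) ** dual2 \<epsilon> g F ** cmat P"
proof -
  define G where "G = cmat (matrix_inv g)"
  define H where "H = cmat minkowski"
  define X where "X = H ** (transpose (cmat P) ** F ** cmat P) ** transpose H"
  define Y where "Y = G ** F ** transpose G"
  let ?d = "\<lambda>x y z w. complex_of_real (det (rows4 x y z w))"
  \<comment> \<open>The dual of \<open>F\<close> as a bilinear form on vectors. Its values on unit
    vectors are the components of \<open>dual2 \<epsilon> g F\<close>, and on columns of
    \<open>P\<close> those in the orthonormal basis.\<close>
  define \<beta> where "\<beta> x y = complex_of_real (\<epsilon> * sqrt \<bar>det g\<bar>) / 2 *
    (\<Sum>m\<in>UNIV. \<Sum>n\<in>UNIV. ?d x y (axis m 1) (axis n 1) * Y $ m $ n)" for x y
  have lin: "linear (\<lambda>x. ?d x y z w)" "linear (\<lambda>y. ?d x y z w)"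
    "linear (\<lambda>z. ?d x y z w)" "linear (\<lambda>w. ?d x y z w)" for x y z w
    using linear_compose[OF linear_det_rows4(1) linear_of_real] linear_compose[OF linear_det_rows4(2) linear_of_real]
      linear_compose[OF linear_det_rows4(3) linear_of_real] linear_compose[OF linear_det_rows4(4) linear_of_real]
    by (simp_all add: o_def)
  have lin_mult: "linear (\<lambda>x. f x * c)" "linear (\<lambda>x. c * f x)" if "linear f" for f :: "real^4 \<Rightarrow> complex" and c
    using that by (auto simp: linear_iff algebra_simps)
  have \<beta>_lin: "linear (\<lambda>x. \<beta> x y)" "linear (\<beta> x)" for x y
    unfolding \<beta>_def[abs_def] by (intro lin_mult linear_compose_sum ballI lin)+
  have G: "G = cmat P ** H ** transpose (cmat P)"
    by (simp add: G_def H_def matrix_inv_lorentz_basis[OF P] cmat_mult cmat_transpose)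
  have Y: "Y = cmat P ** X ** transpose (cmat P)"
    by (simp add: Y_def X_def G matrix_transpose_mul matrix_mul_assoc)
  \<comment> \<open>Taking determinants in the orthonormality relation gives
    \<open>det g * (det P)\<^sup>2 = -1\<close>.\<close>
  have det_g: "sqrt \<bar>det g\<bar> * \<bar>det P\<bar> = 1"
  proof -
    have "det P * det g * det P = det minkowski"
      using arg_cong[OF P, of det] by (simp add: det_mul)
    moreover have "det minkowski = -1" by (simp add: det_4 minkowski_def)
    ultimately have "\<bar>det P * det g * det P\<bar> = 1" by simp
    then have "\<bar>det g\<bar> * \<bar>det P\<bar>\<^sup>2 = 1" by (simp add: abs_mult power2_eq_square ac_simps)
    then have "sqrt (\<bar>det g\<bar> * \<bar>det P\<bar>\<^sup>2) = 1" by simp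
    then show ?thesis by (simp add: real_sqrt_mult)
  qed
  have cols: "?d (column c P) (column d P) (column i P) (column j P) =
      complex_of_real (det P) * ?d (axis c 1) (axis d 1) (axis i 1) (axis j 1)" for c d i j
  proof -
    have "transpose P $ c = column c P" for c
      by (simp add: vec_eq_iff column_def transpose_def)
    then show ?thesis
      using det_rows4_matrix[of "transpose P" c d i j] by (simp add: det_transpose mult.commute)
  qed
  have \<beta>_cols: "\<beta> (column c P) (column d P) = complex_of_real (\<epsilon> * sgn (det P)) / 2 *
     (\<Sum>m\<in>UNIV. \<Sum>n\<in>UNIV. ?d (axis c 1) (axis d 1) (axis m 1) (axis n 1) * X $ m $ n)" for c d
  proof -
    let ?V = "\<chi> m n. ?d (column c P) (column d P) (axis m 1) (axis n 1)"
    have "(\<Sum>m\<in>UNIV. \<Sum>n\<in>UNIV. ?V $ m $ n * Y $ m $ n) = trace (transpose ?V ** Y)"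
      by (rule sum_mult_eq_trace)
    \<comment> \<open>Cyclicity moves the two factors of \<open>Y = P X P^T\<close> onto
      \<open>?V\<close>. Its two remaining slots are then filled with columns of \<open>P\<close> as
      well, so that the determinant has columns of \<open>P\<close> in all four slots.\<close>
    also have "\<dots> = trace (transpose (transpose (cmat P) ** ?V ** cmat P) ** X)"
      unfolding Y matrix_transpose_mul transpose_transpose
      using trace_mul_sym[of "transpose ?V ** cmat P ** X" "transpose (cmat P)"]
        trace_mul_sym[of "transpose ?V" Y]
      by (simp add: matrix_mul_assoc)
    also have "\<dots> = (\<Sum>m\<in>UNIV. \<Sum>n\<in>UNIV. (transpose (cmat P) ** ?V ** cmat P) $ m $ n * X $ m $ n)"
      by (rule sum_mult_eq_trace[symmetric])
    also have "\<dots> = complex_of_real (det P) * (\<Sum>m\<in>UNIV. \<Sum>n\<in>UNIV. ?d (axis c 1) (axis d 1) (axis m 1) (axis n 1) * X $ m $ n)"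
      by (subst congruence_bilinear) (simp_all add: lin cols sum_distrib_left mult.assoc)
    finally have "\<beta> (column c P) (column d P) =
        complex_of_real (\<epsilon> * sqrt \<bar>det g\<bar> * det P) / 2 * (\<Sum>m\<in>UNIV. \<Sum>n\<in>UNIV.
          ?d (axis c 1) (axis d 1) (axis m 1) (axis n 1) * X $ m $ n)"
      by (simp add: \<beta>_def)
    moreover have "sqrt \<bar>det g\<bar> * det P = sgn (det P)"
      using det_g by (cases "det P" "0::real" rule: linorder_cases) auto
    then have "\<epsilon> * sqrt \<bar>det g\<bar> * det P = \<epsilon> * sgn (det P)" by (simp add: mult.assoc)
    ultimately show ?thesis by simp
  qed
  have "sqrt \<bar>det minkowski\<bar> = 1" by (simp add: det_4 minkowski_def)
  then have "dual2 (\<epsilon> * sgn (det P)) minkowski (transpose (cmat P) ** F ** cmat P) =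
      (\<chi> c d. \<beta> (column c P) (column d P))"
    by (simp add: dual2_eq matrix_inv_minkowski \<beta>_cols X_def H_def)
  also have "\<dots> = transpose (cmat P) ** (\<chi> m n. \<beta> (axis m 1) (axis n 1)) ** cmat P"
    by (rule congruence_bilinear[symmetric, OF \<beta>_lin])
  also have "(\<chi> m n. \<beta> (axis m 1) (axis n 1)) = dual2 \<epsilon> g F"
    by (simp add: dual2_eq \<beta>_def Y_def G_def)
  finally show ?thesis .
qed

subsection \<open>Self-dual bivectors in an orthonormal basis\<close>

text \<open>With \<open>c = \<i> \<epsilon>\<close> these are the components of \<open>*A = \<i> A\<close> in an orthonormal basis of orientation
  \<open>\<epsilon>\<close>; with \<open>c = - \<i> \<epsilon>\<close> those of the anti-self-dual condition.\<close>

definition mink_sd :: "complex \<Rightarrow> tensor2 \<Rightarrow> bool" where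
  "mink_sd c A \<longleftrightarrow> (\<forall>a b. A $ a $ b = - A $ b $ a) \<and>
     A $ 3 $ 4 = c * A $ 1 $ 2 \<and> A $ 4 $ 2 = c * A $ 1 $ 3 \<and> A $ 2 $ 3 = c * A $ 1 $ 4"

lemma mink_sd_components:
  assumes "mink_sd c A"
  shows "A $ a $ a = 0" "A $ 2 $ 1 = - A $ 1 $ 2" "A $ 3 $ 1 = - A $ 1 $ 3" "A $ 4 $ 1 = - A $ 1 $ 4"
    "A $ 3 $ 4 = c * A $ 1 $ 2" "A $ 4 $ 3 = - c * A $ 1 $ 2" "A $ 4 $ 2 = c * A $ 1 $ 3"
    "A $ 2 $ 4 = - c * A $ 1 $ 3" "A $ 2 $ 3 = c * A $ 1 $ 4" "A $ 3 $ 2 = - c * A $ 1 $ 4"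
proof -
  have anti: "A $ a $ b = - A $ b $ a" for a b using assms unfolding mink_sd_def by blast
  show "A $ a $ a = 0" using anti[of a a] unfolding eq_neg_iff_add_eq_0 by simp
  show "A $ 2 $ 1 = - A $ 1 $ 2" "A $ 3 $ 1 = - A $ 1 $ 3" "A $ 4 $ 1 = - A $ 1 $ 4"
    by (rule anti)+
  show *: "A $ 3 $ 4 = c * A $ 1 $ 2" "A $ 4 $ 2 = c * A $ 1 $ 3" "A $ 2 $ 3 = c * A $ 1 $ 4"
    using assms unfolding mink_sd_def by blast+
  show "A $ 4 $ 3 = - c * A $ 1 $ 2" "A $ 2 $ 4 = - c * A $ 1 $ 3" "A $ 3 $ 2 = - c * A $ 1 $ 4"
    unfolding anti[of 4 3] anti[of 2 4] anti[of 3 2] * by simp_all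
qed

lemma mink_sd_cnj:
  assumes "mink_sd c A"
  shows "mink_sd (cnj c) (cnj2 A)"
proof -
  have "\<forall>a b. cnj2 A $ a $ b = - cnj2 A $ b $ a"
  proof (intro allI)
    fix a b
    have "A $ a $ b = - A $ b $ a" using assms unfolding mink_sd_def by blast
    then show "cnj2 A $ a $ b = - cnj2 A $ b $ a"
      unfolding cnj2_def by (simp only: vec_lambda_beta complex_cnj_minus)
  qed
  moreover have "cnj2 A $ 3 $ 4 = cnj c * cnj2 A $ 1 $ 2 \<and> cnj2 A $ 4 $ 2 = cnj c * cnj2 A $ 1 $ 3 \<and>
      cnj2 A $ 2 $ 3 = cnj c * cnj2 A $ 1 $ 4"
    using mink_sd_components(5,7,9)[OF assms] by (simp add: cnj2_def)
  ultimately show ?thesis unfolding mink_sd_def by blast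
qed

lemma cmat_minkowski_component:
  "cmat minkowski $ a $ b = (if a = b then if a = 1 then -1 else 1 else 0)"
  by (simp add: cmat_def minkowski_def)

lemma minkowski_lower:
  "(cmat minkowski ** B ** transpose (cmat minkowski)) $ a $ b =
    (if a = 1 then -1 else 1) * (if b = 1 then -1 else 1) * B $ a $ b"
proof -
  have "\<forall>a b. (cmat minkowski ** B ** transpose (cmat minkowski)) $ a $ b =
    (if a = 1 then -1 else 1) * (if b = 1 then -1 else 1) * B $ a $ b"
    unfolding forall_4 matrix_matrix_mult_def transpose_def sum_4 vec_lambda_beta
      cmat_minkowski_component by simp
  then show ?thesis by blast
qed

text \<open>The relations are the components \<open>(1,2)\<close>, \<open>(1,3)\<close>,
  \<open>(1,4)\<close> of the self-duality equation, solved for the spatial components by means of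
  \<open>\<epsilon> * \<epsilon> = 1\<close>.\<close>

lemma sd_bivectors_minkowski:
  assumes "\<epsilon> = 1 \<or> \<epsilon> = -1" and "F \<in> sd_bivectors \<epsilon> minkowski"
  shows "mink_sd (\<i> * \<epsilon>) F"
proof -
  have anti: "F $ a $ b = - F $ b $ a" for a b using assms unfolding sd_bivectors_def by blast
  have *: "sqrt \<bar>det minkowski\<bar> = 1" by (simp add: det_4 minkowski_def)
  have **: "(cmat minkowski ** F ** transpose (cmat minkowski)) $ a $ b =
      (if a = 1 then -1 else 1) * (if b = 1 then -1 else 1) * F $ a $ b" for a b
    by (rule minkowski_lower)
  have dual: "\<i> * F $ a $ b = \<epsilon> / 2 * (\<Sum>m\<in>UNIV. \<Sum>n\<in>UNIV.
      complex_of_real (det (rows4 (axis a 1) (axis b 1) (axis m 1) (axis n 1))) *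
      ((if m = 1 then -1 else 1) * (if n = 1 then -1 else 1) * F $ m $ n))" for a b
  proof -
    have "dual2 \<epsilon> minkowski F $ a $ b = cscale2 \<i> F $ a $ b"
      using assms(2) unfolding sd_bivectors_def by simp
    then show ?thesis
      by (simp add: dual2_eq cscale2_def matrix_inv_minkowski * **)
  qed
  have "\<i> * F $ 1 $ 2 = \<epsilon> * F $ 3 $ 4" "\<i> * F $ 1 $ 3 = \<epsilon> * F $ 4 $ 2" "\<i> * F $ 1 $ 4 = \<epsilon> * F $ 2 $ 3"
    using dual[of 1 2] dual[of 1 3] dual[of 1 4] anti[of 4 3] anti[of 2 4] anti[of 3 2]
    by (simp_all add: sum_4 det_4 rows4_def axis_def)
  then have "F $ 3 $ 4 = \<i> * \<epsilon> * F $ 1 $ 2 \<and> F $ 4 $ 2 = \<i> * \<epsilon> * F $ 1 $ 3 \<and> F $ 2 $ 3 = \<i> * \<epsilon> * F $ 1 $ 4"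
    using assms(1) by (auto simp: mult.assoc)
  then show ?thesis
    using anti unfolding mink_sd_def by blast
qed

text \<open>The metric pairing \<open>A_pq B^pq\<close>, twice \<open>sd_metric\<close> on
  bivectors. The contraction is arranged as in \<open>tensor_map\<close>.\<close>

definition tpair :: "rmetric \<Rightarrow> tensor2 \<Rightarrow> tensor2 \<Rightarrow> complex" where
  "tpair g A B = (\<Sum>m\<in>UNIV. \<Sum>n\<in>UNIV. \<Sum>p\<in>UNIV. \<Sum>q\<in>UNIV.
     A $ p $ q * ginv g p m * ginv g q n * B $ m $ n)"

lemma tpair_eq_trace:
  "tpair g A B = trace (transpose A ** cmat (matrix_inv g) ** B ** transpose (cmat (matrix_inv g)))"
proof -
  define G where "G = cmat (matrix_inv g)"
  have "trace (transpose A ** G ** B ** transpose G) = trace (transpose A ** (G ** B ** transpose G))"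
    by (simp add: matrix_mul_assoc)
  also have "\<dots> = (\<Sum>p\<in>UNIV. \<Sum>q\<in>UNIV. A $ p $ q * (G ** B ** transpose G) $ p $ q)"
    by (rule sum_mult_eq_trace[symmetric])
  also have "\<dots> = (\<Sum>p\<in>UNIV. \<Sum>q\<in>UNIV. \<Sum>n\<in>UNIV. \<Sum>m\<in>UNIV. A $ p $ q * ginv g p m * ginv g q n * B $ m $ n)"
    by (simp add: matrix_matrix_mult_def G_def cmat_def ginv_def transpose_def sum_distrib_left
        sum_distrib_right ac_simps)
  also have "\<dots> = (\<Sum>(p, q, n, m)\<in>UNIV. A $ p $ q * ginv g p m * ginv g q n * B $ m $ n)"
    by (simp add: sum.cartesian_product flip: UNIV_Times_UNIV)
  also have "\<dots> = (\<Sum>(m, n, p, q)\<in>UNIV. A $ p $ q * ginv g p m * ginv g q n * B $ m $ n)"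
    by (rule sum.reindex_bij_witness[of _ "\<lambda>(m, n, p, q). (p, q, n, m)" "\<lambda>(p, q, n, m). (m, n, p, q)"]) auto
  also have "\<dots> = tpair g A B"
    by (simp add: tpair_def sum.cartesian_product flip: UNIV_Times_UNIV)
  finally show ?thesis by (simp add: G_def)
qed

lemma sd_metric_eq_tpair: "sd_metric g F H = tpair g F H / 2"
proof -
  have "(\<Sum>a\<in>UNIV. \<Sum>b\<in>UNIV. \<Sum>m\<in>UNIV. \<Sum>n\<in>UNIV. F $ a $ b * ginv g a m * ginv g b n * H $ m $ n)
     = (\<Sum>(a, b, m, n)\<in>UNIV. F $ a $ b * ginv g a m * ginv g b n * H $ m $ n)"
    by (simp add: sum.cartesian_product flip: UNIV_Times_UNIV)
  also have "\<dots> = (\<Sum>(m, n, a, b)\<in>UNIV. F $ a $ b * ginv g a m * ginv g b n * H $ m $ n)"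
    by (rule sum.reindex_bij_witness[of _ "\<lambda>(m, n, p, q). (p, q, m, n)" "\<lambda>(p, q, m, n). (m, n, p, q)"]) auto
  also have "\<dots> = tpair g F H"
    by (simp add: tpair_def sum.cartesian_product flip: UNIV_Times_UNIV)
  finally show ?thesis by (simp add: sd_metric_def)
qed

lemma dot2_eq: "dot2 g A B = A ** cmat (matrix_inv g) ** B"
  by (simp add: dot2_def matrix_matrix_mult_def cmat_def ginv_def sum_distrib_right)

lemma tpair_minkowski:
  "tpair minkowski A B = (\<Sum>p\<in>UNIV. \<Sum>q\<in>UNIV.
     (if p = 1 then -1 else 1) * (if q = 1 then -1 else 1) * A $ p $ q * B $ p $ q)"
proof -
  have "(cmat minkowski ** B ** transpose (cmat minkowski)) $ a $ b =
      (if a = 1 then -1 else 1) * (if b = 1 then -1 else 1) * B $ a $ b" for a b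
    by (rule minkowski_lower)
  then have "(\<Sum>p\<in>UNIV. \<Sum>q\<in>UNIV. A $ p $ q * (cmat minkowski ** B ** transpose (cmat minkowski)) $ p $ q)
    = (\<Sum>p\<in>UNIV. \<Sum>q\<in>UNIV. (if p = 1 then -1 else 1) * (if q = 1 then -1 else 1) * A $ p $ q * B $ p $ q)"
    by (simp add: ac_simps)
  then show ?thesis
    unfolding tpair_eq_trace matrix_inv_minkowski sum_mult_eq_trace by (simp add: matrix_mul_assoc)
qed

text \<open>Let \<open>e\<close>, \<open>f\<close> be the vectors of free components of
  \<open>A\<close>, \<open>B\<close>. The product has time component \<open>- e.f\<close>, mixed
  components \<open>c (e x f)\<close> and spatial components
  \<open>e_i f_j + e_j f_i - \<delta>_ij e.f\<close>. The opposite duality signs of the factors make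
  it symmetric.\<close>

lemma dot2_minkowski_sd:
  assumes A: "mink_sd c A" and B: "mink_sd (- c) B" and c: "c * c = -1"
  shows "dot2 minkowski A B = (\<chi> a b.
     let e1 = A $ 1 $ 2; e2 = A $ 1 $ 3; e3 = A $ 1 $ 4; f1 = B $ 1 $ 2; f2 = B $ 1 $ 3; f3 = B $ 1 $ 4 in
     if a = 1 \<and> b = 1 then - (e1 * f1 + e2 * f2 + e3 * f3)
     else if {a, b} = {1, 2} then c * (e2 * f3 - e3 * f2)
     else if {a, b} = {1, 3} then c * (e3 * f1 - e1 * f3)
     else if {a, b} = {1, 4} then c * (e1 * f2 - e2 * f1)
     else if a = 2 \<and> b = 2 then e1 * f1 - e2 * f2 - e3 * f3
     else if a = 3 \<and> b = 3 then e2 * f2 - e1 * f1 - e3 * f3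
     else if a = 4 \<and> b = 4 then e3 * f3 - e1 * f1 - e2 * f2
     else if {a, b} = {2, 3} then e1 * f2 + e2 * f1
     else if {a, b} = {2, 4} then e1 * f3 + e3 * f1
     else e2 * f3 + e3 * f2)"
proof -
  have c': "c * (c * x) = - x" for x using c by (simp flip: mult.assoc)
  show ?thesis
    by (simp add: dot2_eq matrix_inv_minkowski matrix_matrix_mult_def sum_4 vec_eq_iff forall_4 Let_def
        cmat_minkowski_component mink_sd_components[OF A] mink_sd_components[OF B] doubleton_eq_iff)
      (simp add: algebra_simps c c')
qed

lemma minkowski_sd_dot:
  assumes A: "mink_sd c A" and B: "mink_sd (- c) B" and c: "c * c = -1"
  shows "transpose (dot2 minkowski A B) = dot2 minkowski A B"
    and "trace (cmat minkowski ** dot2 minkowski A B) = 0"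
proof -
  show "transpose (dot2 minkowski A B) = dot2 minkowski A B"
    by (simp add: dot2_minkowski_sd[OF assms] transpose_def vec_eq_iff forall_4 Let_def doubleton_eq_iff)
  show "trace (cmat minkowski ** dot2 minkowski A B) = 0"
    by (simp add: dot2_minkowski_sd[OF assms] trace_def matrix_matrix_mult_def sum_4 Let_def
        cmat_minkowski_component doubleton_eq_iff)
qed

text \<open>In terms of the free components \<open>e\<close>, \<open>f\<close>, \<open>e'\<close>,
  \<open>f'\<close> both sides equal \<open>4 (e.e') (f.f')\<close>. On the left the mixed
  components contribute \<open>2 (e x f).(e' x f')\<close>; by the Lagrange identity the unwanted
  products cancel against the spatial and time components.\<close>

lemma minkowski_tpair_sd_dot:
  assumes A: "mink_sd c A" and B: "mink_sd (- c) B" and A': "mink_sd c A'" and B': "mink_sd (- c) B'"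
    and c: "c * c = -1"
  shows "tpair minkowski (dot2 minkowski A B) (dot2 minkowski A' B') =
    sd_metric minkowski A A' * sd_metric minkowski B B'"
proof -
  have c': "c * (c * x) = - x" for x using c by (simp flip: mult.assoc)
  have cc: "(c * x) * (c * y) = - (x * y)" for x y using c by (metis c' mult.assoc mult.left_commute)
  \<comment> \<open>Only the square of the duality constant enters, so the same formula serves
    self-dual and anti-self-dual bivectors.\<close>
  have sd: "sd_metric minkowski X Y = -2 * (X $ 1 $ 2 * Y $ 1 $ 2 + X $ 1 $ 3 * Y $ 1 $ 3 + X $ 1 $ 4 * Y $ 1 $ 4)"
    if X: "mink_sd d X" and Y: "mink_sd d Y" and d: "d = c \<or> d = - c" for X Y d
  proof -
    have "(d * x) * (d * y) = - (x * y)" for x y using d cc by auto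
    then show ?thesis
      by (simp add: sd_metric_eq_tpair tpair_minkowski sum_4 mink_sd_components[OF X] mink_sd_components[OF Y])
  qed
  show ?thesis
    unfolding sd[OF A A' disjI1[OF refl]] sd[OF B B' disjI2[OF refl]]
    by (simp add: dot2_minkowski_sd[OF A B c] dot2_minkowski_sd[OF A' B' c] tpair_minkowski sum_4 Let_def
        doubleton_eq_iff cc) algebra
qed

subsection \<open>Self-dual bivectors in an arbitrary basis\<close>

text \<open>The components of a covariant 2-tensor in the basis formed by the columns of
  \<open>P\<close>.\<close>

definition congr :: "real^4^4 \<Rightarrow> tensor2 \<Rightarrow> tensor2" where
  "congr P A = transpose (cmat P) ** A ** cmat P"

lemma antisymmetric_iff: "transpose F = - F \<longleftrightarrow> (\<forall>a b. F $ a $ b = - F $ b $ a)"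
  unfolding vec_eq_iff transpose_def vec_lambda_beta vector_uminus_component by blast

lemma symmetric_iff: "transpose F = F \<longleftrightarrow> (\<forall>a b. F $ a $ b = F $ b $ a)"
  unfolding vec_eq_iff transpose_def vec_lambda_beta by blast

lemma sd_bivectors_transpose: "F \<in> sd_bivectors \<epsilon> g \<Longrightarrow> transpose F = - F"
  unfolding antisymmetric_iff sd_bivectors_def by blast

lemma congr_uminus: "congr P (- A) = - congr P A"
  by (simp add: congr_def matrix_matrix_mult_def vec_eq_iff sum_negf)

lemma cscale2_mult: "cscale2 c A ** B = cscale2 c (A ** B)" "A ** cscale2 c B = cscale2 c (A ** B)"
  by (simp_all add: cscale2_def matrix_matrix_mult_def vec_eq_iff sum_distrib_left mult.assoc mult.left_commute)

lemma scaleR_eq_cscale2: "c *\<^sub>R A = cscale2 (complex_of_real c) A"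
  by (simp add: cscale2_def vec_eq_iff scaleR_conv_of_real[where 'a=complex])

lemma congr_add: "congr P (A + B) = congr P A + congr P B"
  by (simp add: congr_def matrix_matrix_mult_def vec_eq_iff sum.distrib algebra_simps)

lemma congr_scaleR: "congr P (c *\<^sub>R A) = c *\<^sub>R congr P A"
  by (simp add: congr_def scaleR_eq_cscale2 cscale2_mult)

text \<open>The inverse metric is \<open>P ** minkowski ** transpose P\<close>; its outer factors
  complete the congruences of \<open>A\<close> and \<open>B\<close>. The pairing and the trace
  transform for the same reason.\<close>

lemma congr_dot2:
  assumes "transpose P ** g ** P = minkowski"
  shows "congr P (dot2 g A B) = dot2 minkowski (congr P A) (congr P B)"
  by (simp add: congr_def dot2_eq matrix_inv_lorentz_basis[OF assms] matrix_inv_minkowski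
      cmat_mult cmat_transpose matrix_mul_assoc)

lemma congr_tpair:
  assumes "transpose P ** g ** P = minkowski"
  shows "tpair g A B = tpair minkowski (congr P A) (congr P B)"
proof -
  let ?R = "cmat P" and ?H = "cmat minkowski"
  have "tpair g A B = trace (transpose A ** ?R ** ?H ** transpose ?R ** B ** ?R ** transpose ?H ** transpose ?R)"
    by (simp add: tpair_eq_trace matrix_inv_lorentz_basis[OF assms] cmat_mult cmat_transpose
        matrix_transpose_mul matrix_mul_assoc)
  also have "\<dots> = trace (transpose ?R ** (transpose A ** ?R ** ?H ** transpose ?R ** B ** ?R ** transpose ?H))"
    by (rule trace_mul_sym)
  finally show ?thesis
    by (simp add: tpair_eq_trace congr_def matrix_inv_minkowski matrix_transpose_mul matrix_mul_assoc)
qed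

lemma congr_trace:
  assumes "transpose P ** g ** P = minkowski"
  shows "(\<Sum>a\<in>UNIV. \<Sum>b\<in>UNIV. ginv g a b * X $ a $ b) = trace (cmat minkowski ** congr P X)"
proof -
  let ?R = "cmat P" and ?H = "cmat minkowski"
  have H: "transpose ?H = ?H"
    by (simp add: vec_eq_iff transpose_def cmat_minkowski_component)
  have "(\<Sum>a\<in>UNIV. \<Sum>b\<in>UNIV. ginv g a b * X $ a $ b) = trace (transpose (cmat (matrix_inv g)) ** X)"
    unfolding sum_mult_eq_trace[symmetric] by (simp add: cmat_def ginv_def)
  also have "\<dots> = trace (?R ** (?H ** transpose ?R ** X))"
    by (simp add: matrix_inv_lorentz_basis[OF assms] cmat_mult cmat_transpose
        matrix_transpose_mul matrix_mul_assoc H)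
  also have "\<dots> = trace (?H ** transpose ?R ** X ** ?R)"
    by (rule trace_mul_sym)
  finally show ?thesis by (simp add: congr_def matrix_mul_assoc)
qed

lemma congr_cnj2: "congr P (cnj2 A) = cnj2 (congr P A)"
  by (simp add: congr_def cnj2_def matrix_matrix_mult_def transpose_def cmat_def vec_eq_iff)

lemma congr_transpose: "congr P (transpose A) = transpose (congr P A)"
  by (simp add: congr_def matrix_transpose_mul matrix_mul_assoc)

lemma inj_congr:
  assumes "invertible P"
  shows "inj (congr P)"
proof -
  obtain Q where Q: "P ** Q = mat 1" using assms by (auto simp: invertible_def)
  then have RQ: "cmat P ** cmat Q = mat 1" by (simp add: cmat_one flip: cmat_mult)
  then have QR: "transpose (cmat Q) ** transpose (cmat P) = mat 1"
    by (simp flip: matrix_transpose_mul)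
  have "transpose (cmat Q) ** congr P A ** cmat Q = A" for A
  proof -
    have "transpose (cmat Q) ** congr P A ** cmat Q =
        (transpose (cmat Q) ** transpose (cmat P)) ** A ** (cmat P ** cmat Q)"
      by (simp only: congr_def matrix_mul_assoc)
    then show ?thesis by (simp add: RQ QR)
  qed
  then show ?thesis by (rule inj_on_inverseI)
qed

lemma sd_bivectors_iff:
   
  "F \<in> sd_bivectors \<epsilon> g \<longleftrightarrow> transpose F = - F \<and> dual2 \<epsilon> g F = cscale2 \<i> F"
  unfolding sd_bivectors_def antisymmetric_iff mem_Collect_eq ..

lemma congr_sd_bivectors:
  assumes P: "transpose P ** g ** P = minkowski" and F: "F \<in> sd_bivectors \<epsilon> g"
  shows "congr P F \<in> sd_bivectors (\<epsilon> * sgn (det P)) minkowski"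
proof -
  have *: "transpose F = - F" "dual2 \<epsilon> g F = cscale2 \<i> F"
    using F unfolding sd_bivectors_iff by simp_all
  have "transpose (congr P F) = - congr P F"
    by (simp only: * congr_uminus flip: congr_transpose)
  moreover have "dual2 (\<epsilon> * sgn (det P)) minkowski (congr P F) = congr P (cscale2 \<i> F)"
    unfolding *(2)[symmetric] congr_def by (rule dual2_congruence[OF P])
  then have "dual2 (\<epsilon> * sgn (det P)) minkowski (congr P F) = cscale2 \<i> (congr P F)"
    by (simp only: congr_def cscale2_mult)
  ultimately show ?thesis unfolding sd_bivectors_iff ..
qed

text \<open>The constant is \<open>\<i>\<close> times the orientation sign of the new basis, hence
  common to all self-dual bivectors. Since \<open>cnj c = - c\<close>, their conjugates satisfy the
  relations with \<open>- c\<close>.\<close>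

lemma congr_mink_sd:
  assumes P: "transpose P ** g ** P = minkowski" "invertible P" and "orientation \<epsilon>"
  obtains c where "c * c = -1" "cnj c = - c"
    "\<And>F. F \<in> sd_bivectors \<epsilon> g \<Longrightarrow> mink_sd c (congr P F)"
proof
  have "det P \<noteq> 0" using P(2) by (simp add: invertible_det_nz)
  then have s: "\<epsilon> * sgn (det P) = 1 \<or> \<epsilon> * sgn (det P) = -1"
    using assms(3) by (auto simp: orientation_def sgn_if)
  let ?c = "\<i> * complex_of_real (\<epsilon> * sgn (det P))"
  show "?c * ?c = -1" using s by (auto simp del: of_real_mult)
  show "cnj ?c = - ?c" by simp
  show "mink_sd ?c (congr P F)" if "F \<in> sd_bivectors \<epsilon> g" for F
    by (rule sd_bivectors_minkowski[OF s congr_sd_bivectors[OF P(1) that]])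
qed

text \<open>In an orthonormal basis \<open>F\<close> satisfies the relations with \<open>c\<close>
  and \<open>cnj2 H\<close> those with \<open>- c\<close>, so the component computations apply.
  Injectivity of \<open>congr P\<close> carries the symmetry back; trace and pairing are
  invariant.\<close>

lemma
  assumes g: "lorentzian g" and \<epsilon>: "orientation \<epsilon>"
    and F: "F \<in> sd_bivectors \<epsilon> g" and H: "H \<in> sd_bivectors \<epsilon> g"
  shows sd_dot_symmetric: "transpose (dot2 g F (cnj2 H)) = dot2 g F (cnj2 H)"
    and sd_dot_traceless: "(\<Sum>a\<in>UNIV. \<Sum>b\<in>UNIV. ginv g a b * dot2 g F (cnj2 H) $ a $ b) = 0"
    and sd_dot_cnj: "cnj2 (dot2 g F (cnj2 H)) = dot2 g H (cnj2 F)"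
    and sd_dot_pair: "\<lbrakk>F' \<in> sd_bivectors \<epsilon> g; H' \<in> sd_bivectors \<epsilon> g\<rbrakk> \<Longrightarrow>
      tpair g (dot2 g F (cnj2 H)) (dot2 g F' (cnj2 H')) = sd_metric g F F' * cnj (sd_metric g H H')"
proof -
  obtain P where P: "transpose P ** g ** P = minkowski" "invertible P"
    using g by (auto simp: lorentzian_def)
  obtain c where c: "c * c = -1" "cnj c = - c"
    and sd: "\<And>F. F \<in> sd_bivectors \<epsilon> g \<Longrightarrow> mink_sd c (congr P F)"
    by (rule congr_mink_sd[OF P \<epsilon>]) (rule that)
  have asd: "mink_sd (- c) (congr P (cnj2 F))" if "F \<in> sd_bivectors \<epsilon> g" for F
    using mink_sd_cnj[OF sd[OF that]] by (simp add: c congr_cnj2)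
  note inj = inj_congr[OF P(2), THEN injD]
  show sym: "transpose (dot2 g F (cnj2 H)) = dot2 g F (cnj2 H)"
    by (rule inj) (simp add: congr_transpose congr_dot2[OF P(1)] minkowski_sd_dot(1)[OF sd[OF F] asd[OF H] c(1)])
  show "(\<Sum>a\<in>UNIV. \<Sum>b\<in>UNIV. ginv g a b * dot2 g F (cnj2 H) $ a $ b) = 0"
    by (simp add: congr_trace[OF P(1)] congr_dot2[OF P(1)] minkowski_sd_dot(2)[OF sd[OF F] asd[OF H] c(1)])
  \<comment> \<open>By symmetry the product may be transposed first. This reverses the order of the
    factors, and the two signs from antisymmetry cancel.\<close>
  show "cnj2 (dot2 g F (cnj2 H)) = dot2 g H (cnj2 F)"
  proof -
    note anti = sd_bivectors_transpose[OF F] sd_bivectors_transpose[OF H]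
    have "transpose minkowski = minkowski" by (simp add: minkowski_def transpose_def vec_eq_iff)
    then have G: "transpose (cmat (matrix_inv g)) = cmat (matrix_inv g)"
      by (simp add: matrix_inv_lorentz_basis[OF P(1)] matrix_transpose_mul matrix_mul_assoc flip: cmat_transpose)
    have "cnj2 (dot2 g F (cnj2 H)) = cnj2 (transpose (dot2 g F (cnj2 H)))" by (simp only: sym)
    also have "\<dots> = cnj2 (transpose (cnj2 H) ** cmat (matrix_inv g) ** transpose F)"
      by (simp add: dot2_eq matrix_transpose_mul matrix_mul_assoc G)
    also have "transpose (cnj2 H) = cnj2 (transpose H)"
      by (simp add: vec_eq_iff transpose_def cnj2_def)
    also have "cnj2 (cnj2 (transpose H) ** cmat (matrix_inv g) ** transpose F) = dot2 g H (cnj2 F)"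
      unfolding anti dot2_eq
      by (simp add: vec_eq_iff cnj2_def matrix_matrix_mult_def cmat_def sum_negf)
    finally show ?thesis .
  qed
  show "tpair g (dot2 g F (cnj2 H)) (dot2 g F' (cnj2 H')) = sd_metric g F F' * cnj (sd_metric g H H')"
    if "F' \<in> sd_bivectors \<epsilon> g" "H' \<in> sd_bivectors \<epsilon> g" for F' H'
  proof -
    have "sd_metric minkowski (congr P (cnj2 H)) (congr P (cnj2 H')) =
        cnj (sd_metric minkowski (congr P H) (congr P H'))"
      unfolding congr_cnj2 sd_metric_eq_tpair tpair_minkowski sum_4 by (simp add: cnj2_def)
    then show ?thesis
      using minkowski_tpair_sd_dot[OF sd[OF F] asd[OF H] sd[OF that(1)] asd[OF that(2)] c(1)]
      by (simp add: congr_tpair[OF P(1)] congr_dot2[OF P(1)] sd_metric_eq_tpair)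
  qed
qed

section \<open>The space of traceless symmetric tensors\<close>

lemma subspace_traceless_sym: "subspace (traceless_sym g)"
proof -
  have "(\<Sum>a\<in>UNIV. \<Sum>b\<in>UNIV. ginv g a b * (x + y) $ a $ b) =
      (\<Sum>a\<in>UNIV. \<Sum>b\<in>UNIV. ginv g a b * x $ a $ b) + (\<Sum>a\<in>UNIV. \<Sum>b\<in>UNIV. ginv g a b * y $ a $ b)"
    for x y :: tensor2
    by (simp add: distrib_left sum.distrib)
  moreover have "(\<Sum>a\<in>UNIV. \<Sum>b\<in>UNIV. ginv g a b * (c *\<^sub>R x) $ a $ b) =
      c *\<^sub>R (\<Sum>a\<in>UNIV. \<Sum>b\<in>UNIV. ginv g a b * x $ a $ b)" for c and x :: tensor2
    by (simp add: scaleR_sum_right)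
  ultimately show ?thesis
    unfolding subspace_def traceless_sym_def by (auto simp: scaleR_conv_of_real[where 'a=complex])
qed

text \<open>In an orthonormal basis such a tensor is determined by nine real components: symmetry
  gives those below the diagonal, and vanishing trace gives the time component. Equality will follow
  from nine independent elements.\<close>

lemma dim_traceless_sym_le:
  assumes "lorentzian g"
  shows "dim (traceless_sym g) \<le> 9"
proof -
  obtain P where P: "transpose P ** g ** P = minkowski" "invertible P"
    using assms by (auto simp: lorentzian_def)
  define f where "f X = (Re (X $ 1 $ 2), Re (X $ 1 $ 3), Re (X $ 1 $ 4), Re (X $ 2 $ 3), Re (X $ 2 $ 4),
    Re (X $ 3 $ 4), Re (X $ 2 $ 2), Re (X $ 3 $ 3), Re (X $ 4 $ 4))" for X :: tensor2
  have lin: "linear (\<lambda>A. f (congr P A))"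
    by (rule linearI) (simp_all add: f_def congr_add congr_scaleR)
  have zero: "A = 0" if A: "A \<in> traceless_sym g" and f: "f (congr P A) = 0" for A
  proof -
    let ?X = "congr P A"
    have "A $ a $ b \<in> \<real>" for a b using A by (simp add: traceless_sym_def)
    then have Im: "Im (?X $ a $ b) = 0" for a b
      by (simp add: congr_def matrix_matrix_mult_def transpose_def cmat_def complex_is_Real_iff)
    have "transpose A = A" using A unfolding traceless_sym_def symmetric_iff by blast
    then have "transpose ?X = ?X" by (simp flip: congr_transpose)
    then have sym: "?X $ a $ b = ?X $ b $ a" for a b unfolding symmetric_iff by blast
    have "trace (cmat minkowski ** ?X) = 0"
      using A by (simp add: traceless_sym_def congr_trace[OF P(1)])
    then have "?X $ 1 $ 1 = ?X $ 2 $ 2 + ?X $ 3 $ 3 + ?X $ 4 $ 4"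
      by (simp add: trace_def matrix_matrix_mult_def sum_4 cmat_minkowski_component algebra_simps)
    then have "?X = 0"
      using f sym[of 2 1] sym[of 3 1] sym[of 4 1] sym[of 3 2] sym[of 4 2] sym[of 4 3]
      by (simp add: f_def vec_eq_iff forall_4 complex_eq_iff Im zero_prod_def)
    also have "0 = congr P 0" by (simp add: congr_def)
    finally show ?thesis using inj_congr[OF P(2)] by (auto dest: injD)
  qed
  have "inj_on (\<lambda>A. f (congr P A)) (traceless_sym g)"
    unfolding linear_inj_on_iff_eq_0[OF lin subspace_traceless_sym] using zero by blast
  then have "dim (traceless_sym g) = dim ((\<lambda>A. f (congr P A)) ` traceless_sym g)"
    using dim_image_eq[OF lin, of "traceless_sym g"]
    by (simp add: span_eq_iff[THEN iffD2, OF subspace_traceless_sym])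
  also have "\<dots> \<le> DIM(real \<times> real \<times> real \<times> real \<times> real \<times> real \<times> real \<times> real \<times> real)"
    by (rule dim_subset_UNIV)
  finally show ?thesis by simp
qed

subsection \<open>The Bel-Robinson tensor\<close>

lemma tpair_add_left: "tpair g (A + B) C = tpair g A C + tpair g B C"
  and tpair_add_right: "tpair g A (B + C) = tpair g A B + tpair g A C"
  and tpair_diff_left: "tpair g (A - B) C = tpair g A C - tpair g B C"
  and tpair_diff_right: "tpair g A (B - C) = tpair g A B - tpair g A C"
  by (simp_all add: tpair_def distrib_left distrib_right left_diff_distrib right_diff_distrib
      sum.distrib sum_subtractf)

lemma tpair_cscale2_left: "tpair g (cscale2 c A) B = c * tpair g A B"
  and tpair_cscale2_right: "tpair g A (cscale2 c B) = c * tpair g A B"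
  by (simp_all add: tpair_def cscale2_def sum_distrib_left mult.assoc mult.left_commute)

lemmas tpair_bilinear = tpair_add_left tpair_add_right tpair_diff_left tpair_diff_right
  tpair_cscale2_left tpair_cscale2_right

text \<open>A tensor product acts with rank at most one, so the pairings of the frame products
  determine the action of \<open>T\<close> on them.\<close>

lemma tensor_map_tensor_prod: "tensor_map g (A \<otimes>\<^sub>t B) X = cscale2 (tpair g B X) A"
  by (simp add: tensor_map_def tensor_prod_def cscale2_def tpair_def vec_eq_iff sum_distrib_left
      sum_distrib_right mult.assoc mult.left_commute mult.commute)

lemma tensor_map_add_tensor: "tensor_map g (S + T) X = tensor_map g S X + tensor_map g T X"
  and tensor_map_diff_tensor: "tensor_map g (S - T) X = tensor_map g S X - tensor_map g T X"
  by (simp_all add: tensor_map_def vec_eq_iff left_diff_distrib distrib_right sum.distrib sum_subtractf)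

lemma tensor_map_scaleR_tensor: "tensor_map g (c *\<^sub>R T) X = c *\<^sub>R tensor_map g T X"
  by (simp add: tensor_map_def vec_eq_iff scaleR_sum_right)

lemma tensor_map_add: "tensor_map g T (X + Y) = tensor_map g T X + tensor_map g T Y"
  and tensor_map_diff: "tensor_map g T (X - Y) = tensor_map g T X - tensor_map g T Y"
  by (simp_all add: tensor_map_def vec_eq_iff right_diff_distrib distrib_left sum.distrib sum_subtractf)

lemma tensor_map_cscale2: "tensor_map g T (cscale2 c X) = cscale2 c (tensor_map g T X)"
  by (simp add: tensor_map_def cscale2_def vec_eq_iff sum_distrib_left mult.left_commute)

lemma linear_tensor_map: "linear (tensor_map g T)"
  by (rule linearI) (simp_all add: tensor_map_add tensor_map_cscale2 scaleR_eq_cscale2)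

lemma Re2_eq: "Re2 A = cscale2 (1 / 2) (A + cnj2 A)"
  by (simp add: Re2_def cscale2_def cnj2_def vec_eq_iff complex_eq_iff)

lemma Im2_eq: "Im2 A = cscale2 (- \<i> / 2) (A - cnj2 A)"
  by (simp add: Im2_def cscale2_def cnj2_def vec_eq_iff complex_eq_iff)

lemma Re2_Im2_traceless_sym:
  assumes "transpose A = A" and tr: "(\<Sum>a\<in>UNIV. \<Sum>b\<in>UNIV. ginv g a b * A $ a $ b) = 0"
  shows "Re2 A \<in> traceless_sym g" and "Im2 A \<in> traceless_sym g"
proof -
  have sym: "\<forall>a b. A $ a $ b = A $ b $ a" using assms(1) unfolding symmetric_iff .
  have "Re (\<Sum>a\<in>UNIV. \<Sum>b\<in>UNIV. ginv g a b * A $ a $ b) = 0"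
    "Im (\<Sum>a\<in>UNIV. \<Sum>b\<in>UNIV. ginv g a b * A $ a $ b) = 0"
    using tr by simp_all
  then have tr': "(\<Sum>a\<in>UNIV. \<Sum>b\<in>UNIV. matrix_inv g $ a $ b * Re (A $ a $ b)) = 0"
    "(\<Sum>a\<in>UNIV. \<Sum>b\<in>UNIV. matrix_inv g $ a $ b * Im (A $ a $ b)) = 0"
    by (simp_all add: ginv_def)
  have "(\<Sum>a\<in>UNIV. \<Sum>b\<in>UNIV. ginv g a b * Re2 A $ a $ b) = 0"
    using arg_cong[OF tr'(1), of complex_of_real] by (simp add: ginv_def Re2_def)
  moreover have "Re2 A $ a $ b = Re2 A $ b $ a" for a b using sym by (simp add: Re2_def)
  ultimately show "Re2 A \<in> traceless_sym g"
    unfolding traceless_sym_def by (simp add: Re2_def)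
  have "(\<Sum>a\<in>UNIV. \<Sum>b\<in>UNIV. ginv g a b * Im2 A $ a $ b) = 0"
    using arg_cong[OF tr'(2), of complex_of_real] by (simp add: ginv_def Im2_def)
  moreover have "Im2 A $ a $ b = Im2 A $ b $ a" for a b using sym by (simp add: Im2_def)
  ultimately show "Im2 A \<in> traceless_sym g"
    unfolding traceless_sym_def by (simp add: Im2_def)
qed

section \<open>Contraction of the self-dual Weyl tensor with its conjugate\<close>

lemma sum4_product:
  fixes x :: "'a \<Rightarrow> 'c \<Rightarrow> 'e::comm_semiring_0" and y :: "'b \<Rightarrow> 'd \<Rightarrow> 'e"
  shows "(\<Sum>p\<in>A. \<Sum>q\<in>B. \<Sum>r\<in>C. \<Sum>s\<in>D. x p r * y q s) =
    (\<Sum>r\<in>C. \<Sum>p\<in>A. x p r) * (\<Sum>s\<in>D. \<Sum>q\<in>B. y q s)"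
proof -
  have "(\<Sum>p\<in>A. \<Sum>q\<in>B. \<Sum>r\<in>C. \<Sum>s\<in>D. x p r * y q s) =
      (\<Sum>p\<in>A. \<Sum>q\<in>B. (\<Sum>r\<in>C. x p r) * (\<Sum>s\<in>D. y q s))"
    by (simp only: sum_product)
  also have "\<dots> = (\<Sum>p\<in>A. \<Sum>r\<in>C. x p r) * (\<Sum>q\<in>B. \<Sum>s\<in>D. y q s)"
    by (simp only: sum_product[of "\<lambda>p. \<Sum>r\<in>C. x p r"])
  also have "(\<Sum>p\<in>A. \<Sum>r\<in>C. x p r) = (\<Sum>r\<in>C. \<Sum>p\<in>A. x p r)" by (rule sum.swap)
  also have "(\<Sum>q\<in>B. \<Sum>s\<in>D. y q s) = (\<Sum>s\<in>D. \<Sum>q\<in>B. y q s)" by (rule sum.swap)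
  finally show ?thesis .
qed

text \<open>Reversing the indices of both \<open>C\<close> and \<open>E\<close> costs two signs,
  which cancel. The fourfold sum then separates into one over \<open>p, r\<close> and one over
  \<open>q, s\<close>.\<close>

lemma contraction_dot2:
  assumes C: "transpose C = - C" and E: "transpose E = - E"
  shows "(\<Sum>p\<in>UNIV. \<Sum>q\<in>UNIV. \<Sum>r\<in>UNIV. \<Sum>s\<in>UNIV.
      A $ a $ p * B $ b $ q * ginv g p r * ginv g q s * cnj (C $ m $ r) * cnj (E $ n $ s)) =
    dot2 g A (cnj2 C) $ a $ m * dot2 g B (cnj2 E) $ b $ n"
proof -
  have anti: "C $ m $ r = - C $ r $ m" "E $ n $ s = - E $ s $ n" for r s
    using C E unfolding antisymmetric_iff by blast+
  have "A $ a $ p * B $ b $ q * ginv g p r * ginv g q s * cnj (C $ m $ r) * cnj (E $ n $ s) =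
      (A $ a $ p * ginv g p r * cnj (C $ r $ m)) * (B $ b $ q * ginv g q s * cnj (E $ s $ n))" for p q r s
    unfolding anti(1)[of r] anti(2)[of s] by simp
  then show ?thesis
    by (simp only: sum4_product dot2_def cnj2_def vec_lambda_beta)
qed

text \<open>Expanding \<open>2 U U - L K - K L\<close> against its conjugate gives nine
  contractions, each a product of two dot products, with common factor
  \<open>\<rho> * cnj \<rho>\<close>. The two orders of \<open>L\<close> and \<open>K\<close> supply
  the symmetrizations.\<close>

lemma bel_robinson_canonical:
  assumes U: "transpose U = - U" and L: "transpose L = - L" and K: "transpose K = - K"
    and W: "sd_weyl \<epsilon> g W = cscale4 (2 * \<rho>) (U \<otimes>\<^sub>t U) - cscale4 \<rho> (L \<otimes>\<^sub>s K)"
  shows "bel_robinson \<epsilon> g W =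
      (4 * (cmod \<rho>)\<^sup>2) *\<^sub>R (dot2 g U (cnj2 U) \<otimes>\<^sub>t dot2 g U (cnj2 U))
    - (2 * (cmod \<rho>)\<^sup>2) *\<^sub>R (dot2 g U (cnj2 K) \<otimes>\<^sub>s dot2 g U (cnj2 L) + dot2 g K (cnj2 U) \<otimes>\<^sub>s dot2 g L (cnj2 U))
    + (cmod \<rho>)\<^sup>2 *\<^sub>R (dot2 g L (cnj2 L) \<otimes>\<^sub>s dot2 g K (cnj2 K) + dot2 g L (cnj2 K) \<otimes>\<^sub>s dot2 g K (cnj2 L))"
    (is "_ = ?R")
proof -
  define t where "t = \<rho> * cnj \<rho>"
  have t: "complex_of_real ((cmod \<rho>)\<^sup>2) = t"
    unfolding t_def by (rule complex_norm_square)
  define z where "z A B C E a m b n p q r s =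
      A $ a $ p * B $ b $ q * ginv g p r * ginv g q s * cnj (C $ m $ r) * cnj (E $ n $ s)"
    for A B C E :: tensor2 and a m b n p q r s
  have sum_z: "(\<Sum>p\<in>UNIV. \<Sum>q\<in>UNIV. \<Sum>r\<in>UNIV. \<Sum>s\<in>UNIV. z A B C E a m b n p q r s) =
      dot2 g A (cnj2 C) $ a $ m * dot2 g B (cnj2 E) $ b $ n"
    if "transpose C = - C" "transpose E = - E" for A B C E a m b n
    unfolding z_def by (rule contraction_dot2[OF that])
  have S: "sd_weyl \<epsilon> g W $ a $ p $ b $ q = \<rho> * (2 * U $ a $ p * U $ b $ q - L $ a $ p * K $ b $ q - K $ a $ p * L $ b $ q)"
    for a p b q
    by (simp add: W cscale4_def tensor_prod_def sym_tensor_prod_def algebra_simps)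
  have expand: "sd_weyl \<epsilon> g W $ a $ p $ b $ q * ginv g p r * ginv g q s * cnj (sd_weyl \<epsilon> g W $ m $ r $ n $ s) =
      t * (4 * z U U U U a m b n p q r s
        - 2 * (z U U L K a m b n p q r s + z U U K L a m b n p q r s
             + z L K U U a m b n p q r s + z K L U U a m b n p q r s)
        + (z L K L K a m b n p q r s + z L K K L a m b n p q r s
         + z K L L K a m b n p q r s + z K L K L a m b n p q r s))" for a m b n p q r s
    unfolding S z_def t_def complex_cnj_mult complex_cnj_diff complex_cnj_numeral by algebra
  have "bel_robinson \<epsilon> g W $ a $ m $ b $ n = ?R $ a $ m $ b $ n" for a m b n
  proof -
    have "bel_robinson \<epsilon> g W $ a $ m $ b $ n = t * (\<Sum>p\<in>UNIV. \<Sum>q\<in>UNIV. \<Sum>r\<in>UNIV. \<Sum>s\<in>UNIV.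
        4 * z U U U U a m b n p q r s
        - 2 * (z U U L K a m b n p q r s + z U U K L a m b n p q r s
             + z L K U U a m b n p q r s + z K L U U a m b n p q r s)
        + (z L K L K a m b n p q r s + z L K K L a m b n p q r s
         + z K L L K a m b n p q r s + z K L K L a m b n p q r s))"
      by (simp only: bel_robinson_def vec_lambda_beta expand sum_distrib_left)
    also have "\<dots> = ?R $ a $ m $ b $ n"
      by (simp only: sum.distrib sum_subtractf sum_distrib_left[symmetric] sum_z U L K)
        (simp add: scaleR_conv_of_real[where 'a=complex] t tensor_prod_def sym_tensor_prod_def
          del: of_real_power, simp add: algebra_simps)
    finally show ?thesis .
  qed
  then show ?thesis by (intro vec_eq_iff[THEN iffD2] allI)
qed

lemma tpair_commute:
  assumes "lorentzian g"
  shows "tpair g A B = tpair g B A"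
proof -
  obtain P where P: "transpose P ** g ** P = minkowski" using assms by (auto simp: lorentzian_def)
  show ?thesis unfolding congr_tpair[OF P] tpair_minkowski by (simp add: mult.commute mult.left_commute)
qed

lemma cscale2_simps:
  "cscale2 c 0 = 0" "cscale2 0 A = 0" "cscale2 1 A = A" "cscale2 (-1) A = - A"
  "cscale2 c (cscale2 d A) = cscale2 (c * d) A" "cscale2 c (- A) = cscale2 (- c) A"
  by (simp_all add: cscale2_def vec_eq_iff)

lemma cscale2_distrib:
  "cscale2 c (A + B) = cscale2 c A + cscale2 c B" "cscale2 c (A - B) = cscale2 c A - cscale2 c B"
  by (simp_all add: cscale2_def vec_eq_iff algebra_simps)

lemma Re2_real: "cnj2 A = A \<Longrightarrow> Re2 A = A"
  by (simp add: Re2_eq cscale2_def vec_eq_iff)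

lemma tensor_map_Re2_Im2:
  assumes "tensor_map g T A = c *\<^sub>R A" and "tensor_map g T (cnj2 A) = c *\<^sub>R cnj2 A"
  shows "tensor_map g T (Re2 A) = c *\<^sub>R Re2 A" and "tensor_map g T (Im2 A) = c *\<^sub>R Im2 A"
  using assms
  by (simp_all add: Re2_eq Im2_eq tensor_map_cscale2 tensor_map_add tensor_map_diff scaleR_eq_cscale2
      cscale2_distrib cscale2_simps mult.commute)

theorem proposition10:
  fixes g :: "real^4^4" and \<epsilon> t :: real and \<rho> :: complex
    and W T :: tensor4
    and \<U> \<L> \<K> P \<Lambda> K N \<Omega> M :: tensor2
  assumes "lorentzian g" and "orientation \<epsilon>"
    and "weyl_tensor g W" and "petrov_type_D \<epsilon> g W"
    and "null_frame \<epsilon> g \<U> \<L> \<K>" and "\<rho> \<noteq> 0"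
    and "sd_weyl \<epsilon> g W = cscale4 (2 * \<rho>) (\<U> \<otimes>\<^sub>t \<U>) - cscale4 \<rho> (\<L> \<otimes>\<^sub>s \<K>)"
    and "t = (cmod \<rho>)\<^sup>2"
    and "P = dot2 g \<U> (cnj2 \<U>)"
    and "\<Lambda> = dot2 g \<L> (cnj2 \<L>)"
    and "K = dot2 g \<K> (cnj2 \<K>)"
    and "N = dot2 g \<U> (cnj2 \<L>)"
    and "\<Omega> = dot2 g \<U> (cnj2 \<K>)"
    and "M = dot2 g \<L> (cnj2 \<K>)"
    and "T = bel_robinson \<epsilon> g W"
  shows "T = (4 * t) *\<^sub>R (P \<otimes>\<^sub>t P)
           - (2 * t) *\<^sub>R (\<Omega> \<otimes>\<^sub>s N + cnj2 \<Omega> \<otimes>\<^sub>s cnj2 N)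
           + t *\<^sub>R (\<Lambda> \<otimes>\<^sub>s K + M \<otimes>\<^sub>s cnj2 M)
       \<and> alg_multiplicity g T (4 * t) = 1
       \<and> P \<noteq> 0 \<and> eigenspace g T (4 * t) = span {P}
       \<and> alg_multiplicity g T t = 4
       \<and> dim (eigenspace g T t) = 4
       \<and> eigenspace g T t = span {\<Lambda>, K, Re2 M, Im2 M}
       \<and> alg_multiplicity g T (- 2 * t) = 4
       \<and> dim (eigenspace g T (- 2 * t)) = 4
       \<and> eigenspace g T (- 2 * t) = span {Re2 N, Re2 \<Omega>, Im2 N, Im2 \<Omega>}"
proof -

  \<comment> \<open>The frame, its products and the canonical expression\<close>
  note g = assms(1) and \<epsilon> = assms(2)
  have sd: "\<U> \<in> sd_bivectors \<epsilon> g" "\<L> \<in> sd_bivectors \<epsilon> g" "\<K> \<in> sd_bivectors \<epsilon> g"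
    and "sd_metric g \<U> \<U> = -1" "sd_metric g \<L> \<K> = -1" "sd_metric g \<U> \<L> = 0"
      "sd_metric g \<U> \<K> = 0" "sd_metric g \<L> \<L> = 0" "sd_metric g \<K> \<K> = 0"
    using assms(5) unfolding null_frame_def by blast+
  moreover have "sd_metric g \<K> \<L> = sd_metric g \<L> \<K>" "sd_metric g \<L> \<U> = sd_metric g \<U> \<L>"
    "sd_metric g \<K> \<U> = sd_metric g \<U> \<K>"
    by (simp_all add: sd_metric_eq_tpair tpair_commute[OF g, of \<K>] tpair_commute[OF g, of \<L> \<U>])
  ultimately have G: "sd_metric g \<U> \<U> = -1" "sd_metric g \<L> \<K> = -1" "sd_metric g \<K> \<L> = -1"
    "sd_metric g \<U> \<L> = 0" "sd_metric g \<L> \<U> = 0" "sd_metric g \<U> \<K> = 0"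
    "sd_metric g \<K> \<U> = 0"
    "sd_metric g \<L> \<L> = 0" "sd_metric g \<K> \<K> = 0"
    by simp_all
  have t: "t > 0" using assms(6,8) by simp
  \<comment> \<open>The conjugates are introduced as products of frame bivectors, so that the
    pairing formula applies to them too.\<close>
  define N' where "N' = dot2 g \<L> (cnj2 \<U>)"
  define \<Omega>' where "\<Omega>' = dot2 g \<K> (cnj2 \<U>)"
  define M' where "M' = dot2 g \<K> (cnj2 \<L>)"
  note defs = assms(9-14) N'_def \<Omega>'_def M'_def
  have cnj: "cnj2 P = P" "cnj2 \<Lambda> = \<Lambda>" "cnj2 K = K" "cnj2 N = N'" "cnj2 \<Omega> = \<Omega>'" "cnj2 M = M'"
    unfolding defs by (rule sd_dot_cnj[OF g \<epsilon>]; rule sd)+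
  have T: "T = (4 * t) *\<^sub>R (P \<otimes>\<^sub>t P) - (2 * t) *\<^sub>R (\<Omega> \<otimes>\<^sub>s N + \<Omega>' \<otimes>\<^sub>s N')
      + t *\<^sub>R (\<Lambda> \<otimes>\<^sub>s K + M \<otimes>\<^sub>s M')"
    using bel_robinson_canonical[OF sd[THEN sd_bivectors_transpose] assms(7)]
    unfolding assms(15) assms(8) defs .

  \<comment> \<open>The Gram matrix\<close>
  have pair: "tpair g (dot2 g F (cnj2 H)) (dot2 g F' (cnj2 H')) = sd_metric g F F' * cnj (sd_metric g H H')"
    if "F \<in> {\<U>, \<L>, \<K>}" "H \<in> {\<U>, \<L>, \<K>}" "F' \<in> {\<U>, \<L>, \<K>}" "H' \<in> {\<U>, \<L>, \<K>}" for F H F' H'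
    by (rule sd_dot_pair[OF g \<epsilon>]) (use that sd in auto)
  \<comment> \<open>A pairing is nonzero only if both metric factors are, which leaves
    \<open>P\<close> with itself and the pairs \<open>(\<Lambda>, K)\<close>,
    \<open>(N, \<Omega>)\<close>, \<open>(M, M')\<close>, \<open>(N', \<Omega>')\<close>. There the
    two factors \<open>-1\<close> multiply to \<open>1\<close>.\<close>
  have tp:
    "tpair g P P = 1" "tpair g P \<Lambda> = 0" "tpair g P K = 0" "tpair g P N = 0"
    "tpair g P \<Omega> = 0" "tpair g P M = 0" "tpair g P N' = 0" "tpair g P \<Omega>' = 0"
    "tpair g P M' = 0"
    "tpair g \<Lambda> P = 0" "tpair g \<Lambda> \<Lambda> = 0" "tpair g \<Lambda> K = 1"
    "tpair g \<Lambda> N = 0" "tpair g \<Lambda> \<Omega> = 0" "tpair g \<Lambda> M = 0"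
    "tpair g \<Lambda> N' = 0" "tpair g \<Lambda> \<Omega>' = 0" "tpair g \<Lambda> M' = 0"
    "tpair g K P = 0" "tpair g K \<Lambda> = 1" "tpair g K K = 0" "tpair g K N = 0"
    "tpair g K \<Omega> = 0" "tpair g K M = 0" "tpair g K N' = 0" "tpair g K \<Omega>' = 0"
    "tpair g K M' = 0"
    "tpair g N P = 0" "tpair g N \<Lambda> = 0" "tpair g N K = 0" "tpair g N N = 0"
    "tpair g N \<Omega> = 1" "tpair g N M = 0" "tpair g N N' = 0" "tpair g N \<Omega>' = 0"
    "tpair g N M' = 0"
    "tpair g \<Omega> P = 0" "tpair g \<Omega> \<Lambda> = 0" "tpair g \<Omega> K = 0"
    "tpair g \<Omega> N = 1" "tpair g \<Omega> \<Omega> = 0" "tpair g \<Omega> M = 0"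
    "tpair g \<Omega> N' = 0" "tpair g \<Omega> \<Omega>' = 0" "tpair g \<Omega> M' = 0"
    "tpair g M P = 0" "tpair g M \<Lambda> = 0" "tpair g M K = 0" "tpair g M N = 0"
    "tpair g M \<Omega> = 0" "tpair g M M = 0" "tpair g M N' = 0" "tpair g M \<Omega>' = 0"
    "tpair g M M' = 1"
    "tpair g N' P = 0" "tpair g N' \<Lambda> = 0" "tpair g N' K = 0" "tpair g N' N = 0"
    "tpair g N' \<Omega> = 0" "tpair g N' M = 0" "tpair g N' N' = 0" "tpair g N' \<Omega>' = 1"
    "tpair g N' M' = 0"
    "tpair g \<Omega>' P = 0" "tpair g \<Omega>' \<Lambda> = 0" "tpair g \<Omega>' K = 0"
    "tpair g \<Omega>' N = 0" "tpair g \<Omega>' \<Omega> = 0" "tpair g \<Omega>' M = 0"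
    "tpair g \<Omega>' N' = 1" "tpair g \<Omega>' \<Omega>' = 0" "tpair g \<Omega>' M' = 0"
    "tpair g M' P = 0" "tpair g M' \<Lambda> = 0" "tpair g M' K = 0" "tpair g M' N = 0"
    "tpair g M' \<Omega> = 0" "tpair g M' M = 1" "tpair g M' N' = 0" "tpair g M' \<Omega>' = 0"
    "tpair g M' M' = 0"
    unfolding defs by (simp_all add: pair G)
  \<comment> \<open>The dual basis: \<open>P, Re2 M, Im2 M\<close> pair with themselves, the rest as \<open>(\<Lambda>, K)\<close>,
    \<open>(Re2 N, Re2 \<Omega>)\<close>, \<open>(Im2 N, Im2 \<Omega>)\<close>.\<close>
  have gram:
    "tpair g P P = 1" "tpair g P \<Lambda> = 0" "tpair g P K = 0" "tpair g P (Re2 M) = 0"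
    "tpair g P (Im2 M) = 0" "tpair g P (Re2 N) = 0" "tpair g P (Re2 \<Omega>) = 0"
    "tpair g P (Im2 N) = 0" "tpair g P (Im2 \<Omega>) = 0"
    "tpair g \<Lambda> P = 0" "tpair g \<Lambda> \<Lambda> = 0" "tpair g \<Lambda> K = 1"
    "tpair g \<Lambda> (Re2 M) = 0" "tpair g \<Lambda> (Im2 M) = 0" "tpair g \<Lambda> (Re2 N) = 0"
    "tpair g \<Lambda> (Re2 \<Omega>) = 0" "tpair g \<Lambda> (Im2 N) = 0"
    "tpair g \<Lambda> (Im2 \<Omega>) = 0"
    "tpair g K P = 0" "tpair g K \<Lambda> = 1" "tpair g K K = 0" "tpair g K (Re2 M) = 0"
    "tpair g K (Im2 M) = 0" "tpair g K (Re2 N) = 0" "tpair g K (Re2 \<Omega>) = 0"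
    "tpair g K (Im2 N) = 0" "tpair g K (Im2 \<Omega>) = 0"
    "tpair g (Re2 M) P = 0" "tpair g (Re2 M) \<Lambda> = 0" "tpair g (Re2 M) K = 0"
    "tpair g (Re2 M) (Re2 M) = 1 / 2" "tpair g (Re2 M) (Im2 M) = 0" "tpair g (Re2 M) (Re2 N) = 0"
    "tpair g (Re2 M) (Re2 \<Omega>) = 0" "tpair g (Re2 M) (Im2 N) = 0"
    "tpair g (Re2 M) (Im2 \<Omega>) = 0"
    "tpair g (Im2 M) P = 0" "tpair g (Im2 M) \<Lambda> = 0" "tpair g (Im2 M) K = 0"
    "tpair g (Im2 M) (Re2 M) = 0" "tpair g (Im2 M) (Im2 M) = 1 / 2" "tpair g (Im2 M) (Re2 N) = 0"
    "tpair g (Im2 M) (Re2 \<Omega>) = 0" "tpair g (Im2 M) (Im2 N) = 0"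
    "tpair g (Im2 M) (Im2 \<Omega>) = 0"
    "tpair g (Re2 N) P = 0" "tpair g (Re2 N) \<Lambda> = 0" "tpair g (Re2 N) K = 0"
    "tpair g (Re2 N) (Re2 M) = 0" "tpair g (Re2 N) (Im2 M) = 0" "tpair g (Re2 N) (Re2 N) = 0"
    "tpair g (Re2 N) (Re2 \<Omega>) = 1 / 2" "tpair g (Re2 N) (Im2 N) = 0"
    "tpair g (Re2 N) (Im2 \<Omega>) = 0"
    "tpair g (Re2 \<Omega>) P = 0" "tpair g (Re2 \<Omega>) \<Lambda> = 0"
    "tpair g (Re2 \<Omega>) K = 0" "tpair g (Re2 \<Omega>) (Re2 M) = 0"
    "tpair g (Re2 \<Omega>) (Im2 M) = 0" "tpair g (Re2 \<Omega>) (Re2 N) = 1 / 2"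
    "tpair g (Re2 \<Omega>) (Re2 \<Omega>) = 0" "tpair g (Re2 \<Omega>) (Im2 N) = 0"
    "tpair g (Re2 \<Omega>) (Im2 \<Omega>) = 0"
    "tpair g (Im2 N) P = 0" "tpair g (Im2 N) \<Lambda> = 0" "tpair g (Im2 N) K = 0"
    "tpair g (Im2 N) (Re2 M) = 0" "tpair g (Im2 N) (Im2 M) = 0" "tpair g (Im2 N) (Re2 N) = 0"
    "tpair g (Im2 N) (Re2 \<Omega>) = 0" "tpair g (Im2 N) (Im2 N) = 0"
    "tpair g (Im2 N) (Im2 \<Omega>) = - 1 / 2"
    "tpair g (Im2 \<Omega>) P = 0" "tpair g (Im2 \<Omega>) \<Lambda> = 0"
    "tpair g (Im2 \<Omega>) K = 0" "tpair g (Im2 \<Omega>) (Re2 M) = 0"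
    "tpair g (Im2 \<Omega>) (Im2 M) = 0" "tpair g (Im2 \<Omega>) (Re2 N) = 0"
    "tpair g (Im2 \<Omega>) (Re2 \<Omega>) = 0" "tpair g (Im2 \<Omega>) (Im2 N) = - 1 / 2"
    "tpair g (Im2 \<Omega>) (Im2 \<Omega>) = 0"
    by (simp_all add: Re2_eq Im2_eq cnj tpair_bilinear tp)

  \<comment> \<open>The basis of traceless symmetric tensors\<close>
  define B where "B = {P, \<Lambda>, K, Re2 M, Im2 M, Re2 N, Re2 \<Omega>, Im2 N, Im2 \<Omega>}"
  \<comment> \<open>Independence of the set \<open>B\<close> does not exclude coincidences in its
    list of elements. Distinctness is shown by pairing with the dual partner \<open>z\<close> of
    \<open>x\<close>, which separates \<open>x\<close> from the later elements.\<close>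
  have nin: "x \<notin> S" if "\<forall>y\<in>S. tpair g z y \<noteq> tpair g z x" for x S z using that by blast
  have notin1: "P \<notin> {\<Lambda>, K, Re2 M, Im2 M, Re2 N, Re2 \<Omega>, Im2 N, Im2 \<Omega>}"
    by (rule nin[of _ "P"]) (simp add: gram)
  have notin2: "\<Lambda> \<notin> {K, Re2 M, Im2 M, Re2 N, Re2 \<Omega>, Im2 N, Im2 \<Omega>}"
    by (rule nin[of _ "K"]) (simp add: gram)
  have notin3: "K \<notin> {Re2 M, Im2 M, Re2 N, Re2 \<Omega>, Im2 N, Im2 \<Omega>}"
    by (rule nin[of _ "\<Lambda>"]) (simp add: gram)
  have notin4: "Re2 M \<notin> {Im2 M, Re2 N, Re2 \<Omega>, Im2 N, Im2 \<Omega>}"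
    by (rule nin[of _ "Re2 M"]) (simp add: gram)
  have notin5: "Im2 M \<notin> {Re2 N, Re2 \<Omega>, Im2 N, Im2 \<Omega>}"
    by (rule nin[of _ "Im2 M"]) (simp add: gram)
  have notin6: "Re2 N \<notin> {Re2 \<Omega>, Im2 N, Im2 \<Omega>}"
    by (rule nin[of _ "Re2 \<Omega>"]) (simp add: gram)
  have notin7: "Re2 \<Omega> \<notin> {Im2 N, Im2 \<Omega>}"
    by (rule nin[of _ "Re2 N"]) (simp add: gram)
  have notin8: "Im2 N \<notin> {Im2 \<Omega>}"
    by (rule nin[of _ "Im2 \<Omega>"]) (simp add: gram)
  note notin = notin1 notin2 notin3 notin4 notin5 notin6 notin7 notin8
  have card: "card B = 9" "card {\<Lambda>, K, Re2 M, Im2 M} = 4" "card {Re2 N, Re2 \<Omega>, Im2 N, Im2 \<Omega>} = 4"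
    using notin by (simp_all add: B_def)
  \<comment> \<open>The real part of the pairing with \<open>z\<close> is a real-linear
    functional.\<close>
  have dual: "\<exists>f. linear f \<and> f x \<noteq> (0::real) \<and> (\<forall>y\<in>B - {x}. f y = 0)"
    if "Re (tpair g z x) \<noteq> 0" "\<forall>y\<in>B. y = x \<or> Re (tpair g z y) = 0" for x z
    using that by (intro exI[of _ "\<lambda>y. Re (tpair g z y)"] conjI linearI)
      (auto simp: tpair_bilinear scaleR_eq_cscale2)
  have ind: "independent B"
  proof (rule independent_dual)
    fix x assume "x \<in> B"
    then consider "x = P" | "x = \<Lambda>" | "x = K" | "x = Re2 M" | "x = Im2 M" | "x = Re2 N" | "x = Re2 \<Omega>" | "x = Im2 N" | "x = Im2 \<Omega>"
      unfolding B_def by blast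
    then show "\<exists>f. linear f \<and> f x \<noteq> (0::real) \<and> (\<forall>y\<in>B - {x}. f y = 0)"
    proof cases
      case 1
      show ?thesis unfolding 1 by (rule dual[of "P"]) (simp_all add: B_def gram)
    next
      case 2
      show ?thesis unfolding 2 by (rule dual[of "K"]) (simp_all add: B_def gram)
    next
      case 3
      show ?thesis unfolding 3 by (rule dual[of "\<Lambda>"]) (simp_all add: B_def gram)
    next
      case 4
      show ?thesis unfolding 4 by (rule dual[of "Re2 M"]) (simp_all add: B_def gram)
    next
      case 5
      show ?thesis unfolding 5 by (rule dual[of "Im2 M"]) (simp_all add: B_def gram)
    next
      case 6
      show ?thesis unfolding 6 by (rule dual[of "Re2 \<Omega>"]) (simp_all add: B_def gram)
    next
      case 7
      show ?thesis unfolding 7 by (rule dual[of "Re2 N"]) (simp_all add: B_def gram)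
    next
      case 8
      show ?thesis unfolding 8 by (rule dual[of "Im2 \<Omega>"]) (simp_all add: B_def gram)
    next
      case 9
      show ?thesis unfolding 9 by (rule dual[of "Im2 N"]) (simp_all add: B_def gram)
    qed
  qed
  have nz: "b \<noteq> 0" if "b \<in> B" for b using ind that dependent_zero by blast
  note sym = sd_dot_symmetric[OF g \<epsilon>] and tr = sd_dot_traceless[OF g \<epsilon>]
  have Re: "Re2 (dot2 g F (cnj2 H)) \<in> traceless_sym g" and Im: "Im2 (dot2 g F (cnj2 H)) \<in> traceless_sym g"
    if "F \<in> sd_bivectors \<epsilon> g" "H \<in> sd_bivectors \<epsilon> g" for F H
    by (rule Re2_Im2_traceless_sym[OF sym[OF that] tr[OF that]])+
  \<comment> \<open>These three equal their conjugates, hence their own real parts.\<close>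
  have "P \<in> traceless_sym g" "\<Lambda> \<in> traceless_sym g" "K \<in> traceless_sym g"
    using cnj(1-3)[THEN Re2_real] Re sd unfolding defs by metis+
  moreover have "Re2 M \<in> traceless_sym g" "Im2 M \<in> traceless_sym g" "Re2 N \<in> traceless_sym g"
    "Im2 N \<in> traceless_sym g" "Re2 \<Omega> \<in> traceless_sym g"
    "Im2 \<Omega> \<in> traceless_sym g"
    unfolding defs by (rule Re Im; rule sd)+
  ultimately have "B \<subseteq> traceless_sym g" unfolding B_def by blast
  then have "span B \<subseteq> traceless_sym g" by (rule span_minimal[OF _ subspace_traceless_sym])
  \<comment> \<open>The upper bound \<open>9\<close> is attained by the independent set
    \<open>B\<close>, so the inclusion of subspaces is an equality.\<close>
  moreover have "dim (traceless_sym g) \<le> dim (span B)"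
    using dim_traceless_sym_le[OF g] by (simp add: dim_eq_card_independent[OF ind] card)
  ultimately have span: "span B = traceless_sym g"
    by (intro subspace_dim_equal subspace_span subspace_traceless_sym)

  \<comment> \<open>Eigenvalues, eigenspaces and multiplicities\<close>
  note T_simps = T sym_tensor_prod_def tensor_map_add_tensor tensor_map_diff_tensor
    tensor_map_scaleR_tensor tensor_map_tensor_prod tp scaleR_eq_cscale2 cscale2_simps
  \<comment> \<open>On each product only the term of \<open>T\<close> containing it and its dual
    partner acts, and it returns the product itself. The eigenvalue is the coefficient of that
    term.\<close>
  have eigP: "tensor_map g T P = (4 * t) *\<^sub>R P"
    by (simp add: T_simps)
  have eig1: "tensor_map g T \<Lambda> = t *\<^sub>R \<Lambda>" "tensor_map g T K = t *\<^sub>R K"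
    and M: "tensor_map g T M = t *\<^sub>R M" "tensor_map g T (cnj2 M) = t *\<^sub>R cnj2 M"
    by (simp_all add: T_simps cnj)
  have N: "tensor_map g T N = (- 2 * t) *\<^sub>R N" "tensor_map g T (cnj2 N) = (- 2 * t) *\<^sub>R cnj2 N"
    and \<Omega>: "tensor_map g T \<Omega> = (- 2 * t) *\<^sub>R \<Omega>" "tensor_map g T (cnj2 \<Omega>) = (- 2 * t) *\<^sub>R cnj2 \<Omega>"
    by (simp_all add: T_simps cnj) (simp_all add: cscale2_def vec_eq_iff)
  \<comment> \<open>A product and its conjugate share a real eigenvalue, so real and imaginary parts
    inherit it.\<close>
  note eig = eigP eig1 tensor_map_Re2_Im2[OF M] tensor_map_Re2_Im2[OF N] tensor_map_Re2_Im2[OF \<Omega>]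
  have "\<exists>c. tensor_map g T b = c *\<^sub>R b" if "b \<in> B" for b
    using that eig unfolding B_def by blast
  note spaces = eigenspace_eigenbasis[OF linear_tensor_map ind this, unfolded span, folded eigenspace_def]
  have nz': "P \<noteq> 0" "\<Lambda> \<noteq> 0" "K \<noteq> 0" "Re2 M \<noteq> 0" "Im2 M \<noteq> 0" "Re2 N \<noteq> 0" "Re2 \<Omega> \<noteq> 0" "Im2 N \<noteq> 0" "Im2 \<Omega> \<noteq> 0"
    by (rule nz; simp add: B_def)+
  \<comment> \<open>Since \<open>t > 0\<close>, the numbers \<open>4 * t\<close>, \<open>t\<close>,
    \<open>- 2 * t\<close> are distinct, and a nonzero basis element belongs to only one of
    them.\<close>
  have sets: "{b \<in> B. tensor_map g T b = (4 * t) *\<^sub>R b} = {P}"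
    "{b \<in> B. tensor_map g T b = t *\<^sub>R b} = {\<Lambda>, K, Re2 M, Im2 M}"
    "{b \<in> B. tensor_map g T b = (- 2 * t) *\<^sub>R b} = {Re2 N, Re2 \<Omega>, Im2 N, Im2 \<Omega>}"
    using t unfolding B_def by (auto simp: eig nz' simp del: scaleR_minus_left mult_minus_left)
  have dim: "dim (span {b \<in> B. tensor_map g T b = l *\<^sub>R b}) = card {b \<in> B. tensor_map g T b = l *\<^sub>R b}" for l
    by (simp add: dim_eq_card_independent independent_mono[OF ind])
  have eigen: "eigenspace g T l = span {b \<in> B. tensor_map g T b = l *\<^sub>R b}" for l
    by (rule spaces(2))
  have mult: "alg_multiplicity g T l = card {b \<in> B. tensor_map g T b = l *\<^sub>R b}" for l
    unfolding alg_multiplicity_def dim[symmetric] by (rule arg_cong[OF spaces(1), of dim])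
  show ?thesis
    unfolding eigen mult sets
    using T nz'(1) card dim[of t, unfolded sets] dim[of "- 2 * t", unfolded sets] by (simp add: cnj)
qed

end
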